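(* Let $n\ge2$ and $\mu>0$, and assume that $A_i:\mathcal{X}\to2^{\mathcal{X}}$ is $\mu$-strongly maximally monotone for every $i\in[n]=\{1,\ldots,n\}$, so that $A:=\frac1n\sum_{i=1}^nA_i$ is $\mu$-strongly maximally monotone as well and the solution $x^\star$ of $0\in A(x^\star)$ exists and is unique (these consequences are part of the assumption). Assume moreover that average similarity holds with constant $\tilde\delta>0$: for all $x_i\in\mathcal{X}$ and $a_i\in A_i(x_i)$, $i\in[n]$, there exist $a_i^\star\in A_i(x^\star)$, $i\in[n]$, such that $\sum_{i=1}^na_i^\star=0$ and $$\frac1n\sum_{i=1}^n\left\|a_i-\frac1n\sum_{j=1}^na_j-a_i^\star\right\|^2\le\frac{\tilde\delta^2}{n}\sum_{i=1}^n\|x_i-x^\star\|^2.$$ Let $(x^k,(w_i^k)_{i=1}^n)_{k\ge0}$ be generated by the algorithm Point-SAGA described in the context, with any stepsize $\gamma>0$, any initial estimates $x^0\in\mathcal{X}$, $(w_i^0)_{i=1}^n\in\mathcal{X}^n$ and any elements $a_i^0\in A_i(w_i^0)$, $i\in[n]$. Define the Lyapunov function $$V^k:=\|x^k-x^\star\|^2+\gamma\mu\sum_{i=1}^n\|w_i^k-x^\star\|^2.$$ Then, for every $k\ge0$, $$\mathrm{E}\left[V^k\right]\le\max\left\{\frac1{1+\gamma\mu},\;1-\frac1n+\frac{\gamma\tilde\delta^2}{n\mu(1+\gamma\mu)}\right\}^kV^0.$$ Moreover, $x^k$ and all $w_i^k$, $i\in[n]$, converge to $x^\star$ almost surely.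
   Context: $\mathcal{X}$ is a finite-dimensional real Hilbert space with inner product $\langle\cdot,\cdot\rangle$ and norm $\|\cdot\|$; $I$ is the identity. A set-valued operator $B:\mathcal{X}\to 2^{\mathcal{X}}$ has graph $\mathrm{gra}(B)=\{(x,u):u\in B(x)\}$. $B$ is monotone if $\langle u-v,x-y\rangle\ge 0$ for all $(x,u),(y,v)\in\mathrm{gra}(B)$; maximally monotone if moreover no monotone operator has a graph strictly containing $\mathrm{gra}(B)$; $\mu$-strongly maximally monotone if it is maximally monotone and $\langle u-v,x-y\rangle\ge\mu\|x-y\|^2$ for all $(x,u),(y,v)\in\mathrm{gra}(B)$. If $B$ is maximally monotone, the resolvent $(I+B)^{-1}$ is defined everywhere and single-valued. The sum of set-valued operators is the Minkowski sum: $A(x)=\{\frac1n\sum_{i=1}^na_i:a_i\in A_i(x)\}$. Algorithm Point-SAGA, with stepsize $\gamma>0$, initial estimates $x^0$ and $(w_i^0)_{i=1}^n$, initial elements $a_i^0\in A_i(w_i^0)$, and $a^0:=\frac1n\sum_{i=1}^na_i^0$: for $k=0,1,\ldots$ 1. sample $i^k\in[n]$ uniformly at random (independently of the past); 2. set $h^k:=a_{i^k}^k-a^k$; 3. set $x^{k+1}:=(I+\gamma A_{i^k})^{-1}(x^k+\gamma h^k)$; 4. set $w_{i^k}^{k+1}:=x^{k+1}$ and $w_j^{k+1}:=w_j^k$ for every $j\in[n]\setminus\{i^k\}$ (these points are not stored; they are defined only for the analysis); 5. let $a_{i^k}^{k+1}$ be any element of $A_{i^k}(x^{k+1})$ (for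 example $\frac1\gamma(x^k-x^{k+1})+h^k$), and set $a_j^{k+1}:=a_j^k$ for every $j\in[n]\setminus\{i^k\}$; 6. set $a^{k+1}:=a^k+\frac1n(a_{i^k}^{k+1}-a_{i^k}^k)=\frac1n\sum_{j=1}^na_j^{k+1}$. All choices are implicitly measurable and made without knowledge of future samples.
   Formalization: Almost sure convergence is proved only if the max{…} factor is at most 1, or if a_{i^k}^{k+1} is always (1/γ)(x^k − x^{k+1}) + h^k; with arbitrary elements and a factor above 1 it can fail (counterexample on the real line, n = 2, γ = μ = 1, similarity constant 3). *)

theory Defs
  imports "HOL-Probability.Probability"
begin

definition gra :: "('a \<Rightarrow> 'a set) \<Rightarrow> ('a \<times> 'a) set" where
  "gra B = {(x, u). u \<in> B x}"

definition monotone_op :: "('a::real_inner \<Rightarrow> 'a set) \<Rightarrow> bool" where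
  "monotone_op B \<longleftrightarrow> (\<forall>(x, u) \<in> gra B. \<forall>(y, v) \<in> gra B. 0 \<le> (u - v) \<bullet> (x - y))"

definition max_monotone_op :: "('a::real_inner \<Rightarrow> 'a set) \<Rightarrow> bool" where
  "max_monotone_op B \<longleftrightarrow> monotone_op B \<and> (\<forall>C. monotone_op C \<longrightarrow> \<not> gra B \<subset> gra C)"

definition strongly_max_monotone_op :: "real \<Rightarrow> ('a::real_inner \<Rightarrow> 'a set) \<Rightarrow> bool" where
  "strongly_max_monotone_op \<mu> B \<longleftrightarrow> max_monotone_op B \<and>
     (\<forall>(x, u) \<in> gra B. \<forall>(y, v) \<in> gra B. \<mu> * (norm (x - y))\<^sup>2 \<le> (u - v) \<bullet> (x - y))"

text \<open>The set-valued inverse of \<open>I + B\<close>. For maximally monotone \<open>B\<close> every value is a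
  singleton, so \<open>x \<in> resolvent B y\<close> then says that \<open>x\<close> is the value of the resolvent at \<open>y\<close>.\<close>

definition resolvent :: "('a::real_vector \<Rightarrow> 'a set) \<Rightarrow> 'a \<Rightarrow> 'a set" where
  "resolvent B y = {x. \<exists>u \<in> B x. y = x + u}"

definition scale_op :: "real \<Rightarrow> ('a::real_vector \<Rightarrow> 'a set) \<Rightarrow> 'a \<Rightarrow> 'a set" where
  "scale_op \<gamma> B x = (\<lambda>u. \<gamma> *\<^sub>R u) ` B x"

definition avg :: "nat \<Rightarrow> (nat \<Rightarrow> 'a) \<Rightarrow> 'a::real_vector" where
  "avg n a = (1 / real n) *\<^sub>R (\<Sum>i = 1..n. a i)"

definition avg_op :: "nat \<Rightarrow> (nat \<Rightarrow> 'a \<Rightarrow> 'a set) \<Rightarrow> 'a \<Rightarrow> 'a::real_vector set" where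
  "avg_op n A x = {avg n a | a. \<forall>i \<in> {1..n}. a i \<in> A i x}"

definition average_similarity ::
  "nat \<Rightarrow> (nat \<Rightarrow> 'a \<Rightarrow> 'a set) \<Rightarrow> 'a::real_inner \<Rightarrow> real \<Rightarrow> bool" where
  "average_similarity n A xstar \<delta> \<longleftrightarrow>
     (\<forall>x a. (\<forall>i \<in> {1..n}. a i \<in> A i (x i)) \<longrightarrow>
        (\<exists>astar. (\<forall>i \<in> {1..n}. astar i \<in> A i xstar) \<and> (\<Sum>i = 1..n. astar i) = 0 \<and>
           (1 / real n) * (\<Sum>i = 1..n. (norm (a i - avg n a - astar i))\<^sup>2)
             \<le> (\<delta>\<^sup>2 / real n) * (\<Sum>i = 1..n. (norm (x i - xstar))\<^sup>2)))"

definition lyapunov ::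
  "nat \<Rightarrow> real \<Rightarrow> real \<Rightarrow> 'a::real_normed_vector \<Rightarrow> 'a \<Rightarrow> (nat \<Rightarrow> 'a) \<Rightarrow> real" where
  "lyapunov n \<gamma> \<mu> xstar x w =
     (norm (x - xstar))\<^sup>2 + \<gamma> * \<mu> * (\<Sum>i = 1..n. (norm (w i - xstar))\<^sup>2)"

definition rate :: "nat \<Rightarrow> real \<Rightarrow> real \<Rightarrow> real \<Rightarrow> real" where
  "rate n \<gamma> \<mu> \<delta> =
     max (1 / (1 + \<gamma> * \<mu>)) (1 - 1 / real n + \<gamma> * \<delta>\<^sup>2 / (real n * \<mu> * (1 + \<gamma> * \<mu>)))"

text \<open>\<open>F k\<close> is the information available before the \<open>k\<close>-th index \<open>idx k\<close> is drawn; it may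
  contain extra randomness used for the choices made by the algorithm.\<close>

locale uniform_sampling = prob_space M + filtration "space M" F
  for M :: "'w measure" and F :: "nat \<Rightarrow> 'w measure" +
  fixes n :: nat and idx :: "nat \<Rightarrow> 'w \<Rightarrow> nat"
  assumes subalgebra_F: "\<And>k. subalgebra M (F k)"
    and idx_measurable: "\<And>k. idx k \<in> measurable (F (Suc k)) (count_space UNIV)"
    and idx_range: "\<And>k \<omega>. \<omega> \<in> space M \<Longrightarrow> idx k \<omega> \<in> {1..n}"
    and idx_uniform:
      "\<And>k. distr M (count_space UNIV) (idx k) = measure_pmf (pmf_of_set {1..n})"
    and idx_indep: "\<And>k. indep_set (sets (F k)) {idx k -` S \<inter> space M | S. True}"

text \<open>In \<open>w k i \<omega>\<close> and \<open>a k i \<omega>\<close>, \<open>k\<close> is the iteration and \<open>i \<in> {1..n}\<close> the component; \<open>abar\<close>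
  is the running average and \<open>h\<close> the correction. Adaptedness of \<open>a\<close> expresses that its elements are
  chosen measurably and without knowledge of the indices still to be drawn; measurability of \<open>x\<close>
  and \<open>w\<close> then follows for maximally monotone \<open>A i\<close>, whose resolvents are continuous.\<close>

locale point_saga = uniform_sampling M F n idx
  for M :: "'w measure" and F :: "nat \<Rightarrow> 'w measure" and n :: nat
    and idx :: "nat \<Rightarrow> 'w \<Rightarrow> nat" +
  fixes A :: "nat \<Rightarrow> 'a \<Rightarrow> 'a::euclidean_space set"
    and \<gamma> :: real
    and x0 :: 'a and w0 :: "nat \<Rightarrow> 'a" and a0 :: "nat \<Rightarrow> 'a"
    and x :: "nat \<Rightarrow> 'w \<Rightarrow> 'a"
    and w :: "nat \<Rightarrow> nat \<Rightarrow> 'w \<Rightarrow> 'a"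
    and a :: "nat \<Rightarrow> nat \<Rightarrow> 'w \<Rightarrow> 'a"
    and abar :: "nat \<Rightarrow> 'w \<Rightarrow> 'a"
    and h :: "nat \<Rightarrow> 'w \<Rightarrow> 'a"
  assumes stepsize_pos: "\<gamma> > 0"
    and a0_mem: "\<And>i. i \<in> {1..n} \<Longrightarrow> a0 i \<in> A i (w0 i)"
    and x_init: "\<And>\<omega>. \<omega> \<in> space M \<Longrightarrow> x 0 \<omega> = x0"
    and w_init: "\<And>i \<omega>. \<omega> \<in> space M \<Longrightarrow> i \<in> {1..n} \<Longrightarrow> w 0 i \<omega> = w0 i"
    and a_init: "\<And>i \<omega>. \<omega> \<in> space M \<Longrightarrow> i \<in> {1..n} \<Longrightarrow> a 0 i \<omega> = a0 i"
    and abar_init: "\<And>\<omega>. \<omega> \<in> space M \<Longrightarrow> abar 0 \<omega> = avg n a0"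
    and a_adapted: "\<And>k i. i \<in> {1..n} \<Longrightarrow> a k i \<in> borel_measurable (F k)"
    and h_step: "\<And>k \<omega>. \<omega> \<in> space M \<Longrightarrow> h k \<omega> = a k (idx k \<omega>) \<omega> - abar k \<omega>"
    and x_step: "\<And>k \<omega>. \<omega> \<in> space M \<Longrightarrow>
      x (Suc k) \<omega> \<in> resolvent (scale_op \<gamma> (A (idx k \<omega>))) (x k \<omega> + \<gamma> *\<^sub>R h k \<omega>)"
    and w_step: "\<And>k \<omega>. \<omega> \<in> space M \<Longrightarrow> w (Suc k) (idx k \<omega>) \<omega> = x (Suc k) \<omega>"
    and w_keep: "\<And>k j \<omega>. \<omega> \<in> space M \<Longrightarrow> j \<in> {1..n} \<Longrightarrow> j \<noteq> idx k \<omega> \<Longrightarrow>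
      w (Suc k) j \<omega> = w k j \<omega>"
    and a_step: "\<And>k \<omega>. \<omega> \<in> space M \<Longrightarrow> a (Suc k) (idx k \<omega>) \<omega> \<in> A (idx k \<omega>) (x (Suc k) \<omega>)"
    and a_keep: "\<And>k j \<omega>. \<omega> \<in> space M \<Longrightarrow> j \<in> {1..n} \<Longrightarrow> j \<noteq> idx k \<omega> \<Longrightarrow>
      a (Suc k) j \<omega> = a k j \<omega>"
    and abar_step: "\<And>k \<omega>. \<omega> \<in> space M \<Longrightarrow>
      abar (Suc k) \<omega> = abar k \<omega> + (1 / real n) *\<^sub>R (a (Suc k) (idx k \<omega>) \<omega> - a k (idx k \<omega>) \<omega>)"

end

theory Submission
  imports Defs
begin

text \<open>Write \<open>s = \<gamma> \<mu>\<close> and let \<open>d\<close> be the mean over \<open>i\<close> of the squared distance to the solution of the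
  iterate obtained when \<open>i\<close> is drawn. Because the corrections minus the elements \<open>astar i\<close> sum to zero,
  strong monotonicity of the resolvents and average similarity give
  \<open>(1 + s)\<^sup>2 d \<le> \<parallel>x - xstar\<parallel>\<^sup>2 + \<gamma>\<^sup>2 \<delta>\<^sup>2 W / n\<close>, where \<open>W\<close> is the sum of the squared distances of the points
  \<open>w i\<close>. As only one point is replaced, the conditional mean of the next \<open>W\<close> is \<open>(1 - 1/n) W + d\<close>. Every
  weighted sum of \<open>\<parallel>x - xstar\<parallel>\<^sup>2\<close> and \<open>W\<close> can then be estimated; the weight \<open>s\<close> gives the rate. Almost
  sure convergence follows from a potential whose expected decrease dominates the Lyapunov function,
  as the sum of the expected decreases is bounded by the initial potential.\<close>

subsection \<open>Resolvents of strongly monotone operators\<close>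

text \<open>Otherwise adding the pair \<open>(x, u)\<close> to the graph would give a strictly
  larger monotone operator.\<close>

lemma max_monotone_opD:
  assumes B: "max_monotone_op B"
    and rel: "\<And>y v. v \<in> B y \<Longrightarrow> 0 \<le> (u - v) \<bullet> (x - y)"
  shows "u \<in> B x"
proof (rule ccontr)
  assume nin: "u \<notin> B x"
  define C where "C = (\<lambda>z. if z = x then insert u (B x) else B z)"
  have gC: "gra C = insert (x, u) (gra B)"
    by (auto simp: gra_def C_def split: if_splits)
  have rel': "0 \<le> (v - u) \<bullet> (y - x)" if "v \<in> B y" for y v
    using rel[OF that] by (simp add: inner_diff_left inner_diff_right)
  have "monotone_op B" using B by (simp add: max_monotone_op_def)
  then have "monotone_op C"
    using rel rel' unfolding monotone_op_def gC by (auto simp: gra_def)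
  moreover have "gra B \<subset> gra C"
    using nin unfolding gC by (auto simp: gra_def)
  ultimately show False
    using B by (auto simp: max_monotone_op_def)
qed

text \<open>The monotonicity inequality against each fixed pair of the graph passes to the limit,
  and maximality then admits the limit pair.\<close>

lemma max_monotone_op_closed_gra:
  assumes B: "max_monotone_op B"
    and u: "\<And>k. u k \<in> B (x k)" and lim: "x \<longlonglongrightarrow> x'" "u \<longlonglongrightarrow> u'"
  shows "u' \<in> B x'"
proof (rule max_monotone_opD[OF B])
  fix y v assume v: "v \<in> B y"
  have "(\<lambda>k. (u k - v) \<bullet> (x k - y)) \<longlonglongrightarrow> (u' - v) \<bullet> (x' - y)"
    by (intro tendsto_intros lim)
  moreover have "0 \<le> (u k - v) \<bullet> (x k - y)" for k
    using B u[of k] v by (force simp: max_monotone_op_def monotone_op_def gra_def)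
  ultimately show "0 \<le> (u' - v) \<bullet> (x' - y)"
    by (intro LIMSEQ_le_const) auto
qed

lemma resolvent_scale_op_iff:
  assumes "\<gamma> > 0"
  shows "p \<in> resolvent (scale_op \<gamma> B) y \<longleftrightarrow> (1 / \<gamma>) *\<^sub>R (y - p) \<in> B p"
proof
  assume "p \<in> resolvent (scale_op \<gamma> B) y"
  then obtain u where "u \<in> B p" "y = p + \<gamma> *\<^sub>R u"
    by (auto simp: resolvent_def scale_op_def)
  then show "(1 / \<gamma>) *\<^sub>R (y - p) \<in> B p"
    using assms by simp
next
  assume "(1 / \<gamma>) *\<^sub>R (y - p) \<in> B p"
  then show "p \<in> resolvent (scale_op \<gamma> B) y"
    using assms by (auto simp: resolvent_def scale_op_def image_iff intro!: bexI)
qed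

text \<open>Monotonicity at the two values yields firm nonexpansiveness, and Cauchy-Schwarz does the
  rest. The case \<open>y = z\<close> shows that the resolvent has at most one value.\<close>

lemma resolvent_nonexpansive:
  assumes "monotone_op B" "\<gamma> > 0"
    and p: "p \<in> resolvent (scale_op \<gamma> B) y" and q: "q \<in> resolvent (scale_op \<gamma> B) z"
  shows "norm (p - q) \<le> norm (y - z)"
proof -
  have "0 \<le> ((1 / \<gamma>) *\<^sub>R (y - p) - (1 / \<gamma>) *\<^sub>R (z - q)) \<bullet> (p - q)"
    using assms by (force simp: resolvent_scale_op_iff monotone_op_def gra_def)
  also have "\<dots> = (1 / \<gamma>) * ((y - z) \<bullet> (p - q) - (norm (p - q))\<^sup>2)"
    by (simp add: power2_norm_eq_inner algebra_simps)
  finally have "(norm (p - q))\<^sup>2 \<le> (y - z) \<bullet> (p - q)"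
    using \<open>\<gamma> > 0\<close> by (simp add: zero_le_mult_iff zero_le_divide_iff)
  also have "\<dots> \<le> norm (y - z) * norm (p - q)"
    by (rule norm_cauchy_schwarz)
  finally show ?thesis
    by (cases "p = q") (auto simp: power2_eq_square)
qed

text \<open>A total version of the resolvent. The value \<open>z\<close> outside of its domain makes Minty's theorem
  unnecessary: with \<open>z\<close> the solution, all the estimates below hold trivially there.\<close>

definition resolvent_or :: "'a \<Rightarrow> real \<Rightarrow> ('a::real_vector \<Rightarrow> 'a set) \<Rightarrow> 'a \<Rightarrow> 'a" where
  "resolvent_or z \<gamma> B y =
     (if resolvent (scale_op \<gamma> B) y = {} then z else SOME p. p \<in> resolvent (scale_op \<gamma> B) y)"

lemma resolvent_or_mem:
  "resolvent (scale_op \<gamma> B) y \<noteq> {} \<Longrightarrow> resolvent_or z \<gamma> B y \<in> resolvent (scale_op \<gamma> B) y"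
  by (auto simp: resolvent_or_def intro: someI)

lemma resolvent_or_eqI:
  assumes "monotone_op B" "\<gamma> > 0" "p \<in> resolvent (scale_op \<gamma> B) y"
  shows "resolvent_or z \<gamma> B y = p"
proof -
  have "resolvent_or z \<gamma> B y \<in> resolvent (scale_op \<gamma> B) y"
    using assms(3) by (intro resolvent_or_mem) auto
  from resolvent_nonexpansive[OF assms(1,2) this assms(3)] show ?thesis by simp
qed

text \<open>By nonexpansiveness the values along a convergent sequence of arguments are Cauchy;
  since the graph is closed, their limit is a value at the limit argument.\<close>

lemma closed_resolvent_domain:
  fixes B :: "'a::euclidean_space \<Rightarrow> 'a set"
  assumes B: "max_monotone_op B" and \<gamma>: "\<gamma> > 0"
  shows "closed {y. resolvent (scale_op \<gamma> B) y \<noteq> {}}"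
  unfolding closed_sequential_limits
proof safe
  fix y y' assume "\<forall>k. y k \<in> {y. resolvent (scale_op \<gamma> B) y \<noteq> {}}" and lim: "y \<longlonglongrightarrow> y'"
    and empty: "resolvent (scale_op \<gamma> B) y' = {}"
  then have ne: "\<And>k. resolvent (scale_op \<gamma> B) (y k) \<noteq> {}" by simp
  define p where "p k = resolvent_or 0 \<gamma> B (y k)" for k
  have p: "p k \<in> resolvent (scale_op \<gamma> B) (y k)" for k
    unfolding p_def by (rule resolvent_or_mem[OF ne])
  have mono: "monotone_op B" using B by (simp add: max_monotone_op_def)
  have "Cauchy p"
    using resolvent_nonexpansive[OF mono \<gamma> p p] LIMSEQ_imp_Cauchy[OF lim]
    unfolding Cauchy_def dist_norm by (meson order_le_less_trans)
  then obtain p' where p': "p \<longlonglongrightarrow> p'"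
    by (auto simp: Cauchy_convergent_iff convergent_def)
  have "(1 / \<gamma>) *\<^sub>R (y' - p') \<in> B p'"
    using p \<gamma> by (intro max_monotone_op_closed_gra[OF B _ p', of "\<lambda>k. (1 / \<gamma>) *\<^sub>R (y k - p k)"]
        tendsto_intros lim p') (simp add: resolvent_scale_op_iff)
  then show False
    using empty \<gamma> by (auto simp flip: resolvent_scale_op_iff)
qed

text \<open>The function is 1-Lipschitz on the closed domain of the resolvent and constant off
  it.\<close>

lemma borel_measurable_resolvent_or:
  fixes B :: "'a::euclidean_space \<Rightarrow> 'a set"
  assumes B: "max_monotone_op B" and \<gamma>: "\<gamma> > 0"
  shows "resolvent_or z \<gamma> B \<in> borel_measurable borel"
proof -
  let ?D = "{y. resolvent (scale_op \<gamma> B) y \<noteq> {}}"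
  have mono: "monotone_op B" using B by (simp add: max_monotone_op_def)
  have "1-lipschitz_on ?D (resolvent_or z \<gamma> B)"
    using resolvent_nonexpansive[OF mono \<gamma> resolvent_or_mem resolvent_or_mem]
    by (auto simp: lipschitz_on_def dist_norm)
  then have "continuous_on ?D (resolvent_or z \<gamma> B)"
    by (rule lipschitz_on_continuous_on)
  then have "(\<lambda>y. if y \<in> ?D then resolvent_or z \<gamma> B y else z) \<in> borel_measurable borel"
    using closed_resolvent_domain[OF B \<gamma>]
    by (intro borel_measurable_continuous_on_if) auto
  also have "(\<lambda>y. if y \<in> ?D then resolvent_or z \<gamma> B y else z) = resolvent_or z \<gamma> B"
    by (auto simp: resolvent_or_def)
  finally show ?thesis .
qed

text \<open>This is strong monotonicity between the pair of the resolvent value and the pair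
  \<open>(z, u)\<close>, multiplied by \<open>\<gamma>\<close>. Outside the domain the value is
  \<open>z\<close> and both sides vanish.\<close>

lemma resolvent_or_inner_ge:
  fixes B :: "'a::real_inner \<Rightarrow> 'a set"
  assumes B: "strongly_max_monotone_op \<mu> B" and \<gamma>: "\<gamma> > 0" and u: "u \<in> B z"
  shows "\<gamma> * \<mu> * (norm (resolvent_or z \<gamma> B y - z))\<^sup>2
           \<le> (y - \<gamma> *\<^sub>R u - resolvent_or z \<gamma> B y) \<bullet> (resolvent_or z \<gamma> B y - z)"
proof (cases "resolvent (scale_op \<gamma> B) y = {}")
  case True
  then show ?thesis by (simp add: resolvent_or_def)
next
  case False
  define p where "p = resolvent_or z \<gamma> B y"
  have "(1 / \<gamma>) *\<^sub>R (y - p) \<in> B p"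
    using resolvent_or_mem[OF False, of z] \<gamma> by (simp add: p_def resolvent_scale_op_iff)
  then have "\<mu> * (norm (p - z))\<^sup>2 \<le> ((1 / \<gamma>) *\<^sub>R (y - p) - u) \<bullet> (p - z)"
    using B u by (force simp: strongly_max_monotone_op_def gra_def)
  then have "\<gamma> * (\<mu> * (norm (p - z))\<^sup>2) \<le> \<gamma> * (((1 / \<gamma>) *\<^sub>R (y - p) - u) \<bullet> (p - z))"
    using \<gamma> by simp
  also have "\<dots> = (\<gamma> *\<^sub>R ((1 / \<gamma>) *\<^sub>R (y - p) - u)) \<bullet> (p - z)"
    by simp
  also have "\<gamma> *\<^sub>R ((1 / \<gamma>) *\<^sub>R (y - p) - u) = y - \<gamma> *\<^sub>R u - p"
    using \<gamma> by (simp add: scaleR_diff_right)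
  finally show ?thesis by (simp add: p_def mult.assoc)
qed

text \<open>The square of \<open>r + p\<close> is expanded and its cross term bounded by strong
  monotonicity. The residual \<open>r\<close> is kept: for the canonical element it is
  \<open>\<gamma>\<close> times the difference to the element at the solution.\<close>

lemma resolvent_or_three_point:
  fixes B :: "'a::real_inner \<Rightarrow> 'a set"
  assumes "strongly_max_monotone_op \<mu> B" "\<gamma> > 0" "u \<in> B z"
  shows "(1 + 2 * (\<gamma> * \<mu>)) * (norm (resolvent_or z \<gamma> B y - z))\<^sup>2
           + (norm (y - \<gamma> *\<^sub>R u - resolvent_or z \<gamma> B y))\<^sup>2 \<le> (norm (y - \<gamma> *\<^sub>R u - z))\<^sup>2"
proof -
  define p r where "p = resolvent_or z \<gamma> B y - z" and "r = y - \<gamma> *\<^sub>R u - resolvent_or z \<gamma> B y"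
  have "y - \<gamma> *\<^sub>R u - z = r + p" by (simp add: p_def r_def)
  moreover have "(norm (r + p))\<^sup>2 = (norm p)\<^sup>2 + 2 * (r \<bullet> p) + (norm r)\<^sup>2"
    by (simp add: power2_norm_eq_inner algebra_simps inner_commute)
  moreover have "\<gamma> * \<mu> * (norm p)\<^sup>2 \<le> r \<bullet> p"
    unfolding p_def r_def by (rule resolvent_or_inner_ge[OF assms])
  ultimately show ?thesis
    unfolding p_def[symmetric] r_def[symmetric] by (simp add: algebra_simps)
qed

text \<open>Here the cross term is treated by Cauchy-Schwarz. The residual is lost, but the factor
  improves from \<open>1 + 2 * (\<gamma> * \<mu>)\<close> to
  \<open>(1 + \<gamma> * \<mu>)\<^sup>2\<close>.\<close>

lemma resolvent_or_contraction:
  fixes B :: "'a::real_inner \<Rightarrow> 'a set"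
  assumes B: "strongly_max_monotone_op \<mu> B" "\<gamma> > 0" "u \<in> B z" and "\<mu> > 0"
  shows "(1 + \<gamma> * \<mu>)\<^sup>2 * (norm (resolvent_or z \<gamma> B y - z))\<^sup>2 \<le> (norm (y - \<gamma> *\<^sub>R u - z))\<^sup>2"
proof -
  define p r where "p = resolvent_or z \<gamma> B y - z" and "r = y - \<gamma> *\<^sub>R u - resolvent_or z \<gamma> B y"
  have rp: "r + p = y - \<gamma> *\<^sub>R u - z" by (simp add: p_def r_def)
  have "\<gamma> * \<mu> * (norm p)\<^sup>2 \<le> r \<bullet> p"
    unfolding p_def r_def by (rule resolvent_or_inner_ge[OF B])
  \<comment> \<open>Adding \<open>p \<bullet> p\<close> to both sides turns \<open>r\<close> into
    \<open>r + p\<close>, the full distance to the solution.\<close>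
  then have "(1 + \<gamma> * \<mu>) * (norm p)\<^sup>2 \<le> (r + p) \<bullet> p"
    by (simp add: inner_add_left power2_norm_eq_inner algebra_simps)
  also have "\<dots> \<le> norm (r + p) * norm p"
    by (rule norm_cauchy_schwarz)
  finally have "(1 + \<gamma> * \<mu>) * norm p \<le> norm (r + p)"
    by (cases "p = 0") (auto simp: power2_eq_square)
  then have "((1 + \<gamma> * \<mu>) * norm p)\<^sup>2 \<le> (norm (r + p))\<^sup>2"
    using assms by (intro power_mono) auto
  then show ?thesis
    by (simp add: power_mult_distrib rp flip: p_def)
qed

subsection \<open>Averages over the components\<close>

text \<open>Bias-variance decomposition: the cross terms add up to the inner product of
  \<open>z\<close> with the sum of the \<open>b i\<close>, which is zero.\<close>

lemma sum_norm_shift_centered: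
  fixes b :: "'i \<Rightarrow> 'a::real_inner"
  assumes "(\<Sum>i\<in>I. b i) = 0"
  shows "(\<Sum>i\<in>I. (norm (z + b i))\<^sup>2) = card I * (norm z)\<^sup>2 + (\<Sum>i\<in>I. (norm (b i))\<^sup>2)"
proof -
  have "(\<Sum>i\<in>I. (norm (z + b i))\<^sup>2) = (\<Sum>i\<in>I. (norm z)\<^sup>2 + 2 * (z \<bullet> b i) + (norm (b i))\<^sup>2)"
    by (simp add: power2_norm_eq_inner algebra_simps inner_commute)
  also have "\<dots> = card I * (norm z)\<^sup>2 + 2 * (z \<bullet> (\<Sum>i\<in>I. b i)) + (\<Sum>i\<in>I. (norm (b i))\<^sup>2)"
    by (simp add: sum.distrib inner_sum_right sum_distrib_left)
  finally show ?thesis by (simp add: assms)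
qed

lemma sum_diff_avg:
  assumes "n > 0"
  shows "(\<Sum>i = 1..n. a i - avg n a) = 0"
  using assms by (simp add: sum_subtractf avg_def flip: scaleR_sum_left sum_constant_scaleR)

text \<open>A variance is at most the second moment; the difference is the squared norm of the
  average, \<open>n\<close> times.\<close>

lemma sum_norm_diff_avg_le:
  fixes a :: "nat \<Rightarrow> 'a::real_inner"
  assumes "n > 0"
  shows "(\<Sum>i = 1..n. (norm (a i - avg n a))\<^sup>2) \<le> (\<Sum>i = 1..n. (norm (a i))\<^sup>2)"
  using sum_norm_shift_centered[OF sum_diff_avg[OF assms], of "avg n a" a] by simp

text \<open>Each old entry survives in all but one of the updated families, and each new entry
  occurs in exactly one. Divided by the number of indices, this is the mean effect of replacing one
  uniformly drawn entry.\<close>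

lemma sum_fun_upd_diagonal:
  fixes f :: "'i \<Rightarrow> 'a \<Rightarrow> real"
  assumes "finite I"
  shows "(\<Sum>i\<in>I. \<Sum>j\<in>I. f j ((v(i := p i)) j))
    = (real (card I) - 1) * (\<Sum>j\<in>I. f j (v j)) + (\<Sum>i\<in>I. f i (p i))"
proof -
  have "(\<Sum>j\<in>I. f j ((v(i := p i)) j)) = (\<Sum>j\<in>I. f j (v j)) - f i (v i) + f i (p i)"
    if "i \<in> I" for i
    using assms that by (simp add: sum.remove[of I i])
  then have "(\<Sum>i\<in>I. \<Sum>j\<in>I. f j ((v(i := p i)) j))
      = (\<Sum>i\<in>I. (\<Sum>j\<in>I. f j (v j)) - f i (v i) + f i (p i))"
    by simp
  then show ?thesis by (simp add: sum.distrib sum_subtractf algebra_simps)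
qed

text \<open>Subtracting a family with sum zero leaves the average unchanged, so the variance bound
  applies to the differences.\<close>

lemma sum_norm_diff_avg_centered_le:
  fixes a b :: "nat \<Rightarrow> 'a::real_inner"
  assumes "n > 0" and "(\<Sum>i = 1..n. b i) = 0"
  shows "(\<Sum>i = 1..n. (norm (a i - avg n a - b i))\<^sup>2) \<le> (\<Sum>i = 1..n. (norm (a i - b i))\<^sup>2)"
proof -
  have "avg n (\<lambda>i. a i - b i) = avg n a"
    using assms(2) by (simp add: avg_def sum_subtractf)
  then show ?thesis
    using sum_norm_diff_avg_le[OF assms(1), of "\<lambda>i. a i - b i"] by (simp add: algebra_simps)
qed

lemma borel_measurable_norm_diff_sq:
  fixes f :: "'b \<Rightarrow> 'a::euclidean_space"
  shows "f \<in> borel_measurable N \<Longrightarrow> (\<lambda>\<omega>. (norm (f \<omega> - z))\<^sup>2) \<in> borel_measurable N"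
  by (rule measurable_compose[of f N borel "\<lambda>y. (norm (y - z))\<^sup>2"])
    (auto intro!: borel_measurable_continuous_onI continuous_intros)

lemma lyapunov_nonneg: "0 \<le> g \<Longrightarrow> 0 \<le> \<mu> \<Longrightarrow> 0 \<le> lyapunov n g \<mu> z y v"
  by (simp add: lyapunov_def sum_nonneg)

text \<open>The point \<open>p i\<close> enters twice, as the new iterate with weight 1 and as the
  replaced entry with weight \<open>g * \<mu>\<close>.\<close>

lemma sum_lyapunov_fun_upd:
  "(\<Sum>i = 1..n. lyapunov n g \<mu> z (p i) (v(i := p i)))
     = (1 + g * \<mu>) * (\<Sum>i = 1..n. (norm (p i - z))\<^sup>2)
       + g * \<mu> * (real n - 1) * (\<Sum>i = 1..n. (norm (v i - z))\<^sup>2)"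
  unfolding lyapunov_def sum.distrib sum_distrib_left[symmetric]
  by (subst sum_fun_upd_diagonal[where f = "\<lambda>_ y. (norm (y - z))\<^sup>2"]) (auto simp: algebra_simps)

text \<open>A positive multiple of each squared distance is dominated by the Lyapunov
  function.\<close>

lemma lyapunov_tendsto_zeroD:
  assumes "g * \<mu> > 0" and lim: "(\<lambda>k. lyapunov n g \<mu> z (y k) (v k)) \<longlonglongrightarrow> 0"
  shows "y \<longlonglongrightarrow> z" and "i \<in> {1..n} \<Longrightarrow> (\<lambda>k. v k i) \<longlonglongrightarrow> z"
proof -
  have conv: "f \<longlonglongrightarrow> z"
    if "c > 0" and le: "\<And>k. c * (norm (f k - z))\<^sup>2 \<le> lyapunov n g \<mu> z (y k) (v k)" for f c
  proof -
    have "(\<lambda>k. c * (norm (f k - z))\<^sup>2) \<longlonglongrightarrow> 0"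
      by (rule tendsto_sandwich[OF _ _ tendsto_const lim]) (use that in auto)
    then have "(\<lambda>k. (1 / c) * (c * (norm (f k - z))\<^sup>2)) \<longlonglongrightarrow> (1 / c) * 0"
      by (intro tendsto_mult_left)
    then have "(\<lambda>k. (norm (f k - z))\<^sup>2) \<longlonglongrightarrow> 0"
      using \<open>c > 0\<close> by simp
    then have "(\<lambda>k. sqrt ((norm (f k - z))\<^sup>2)) \<longlonglongrightarrow> sqrt 0"
      by (rule tendsto_real_sqrt)
    then show ?thesis
      by (simp add: tendsto_norm_zero_iff LIM_zero_iff)
  qed
  have "0 \<le> g * \<mu> * (\<Sum>i = 1..n. (norm (v k i - z))\<^sup>2)" for k
    using assms(1) by (intro mult_nonneg_nonneg[OF less_imp_le] sum_nonneg) auto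
  then show "y \<longlonglongrightarrow> z"
    by (intro conv[of 1]) (simp_all add: lyapunov_def)
  assume i: "i \<in> {1..n}"
  show "(\<lambda>k. v k i) \<longlonglongrightarrow> z"
  proof (rule conv[OF assms(1)])
    fix k
    have "(norm (v k i - z))\<^sup>2 \<le> (\<Sum>j = 1..n. (norm (v k j - z))\<^sup>2)"
      using i by (intro member_le_sum) auto
    then have "g * \<mu> * (norm (v k i - z))\<^sup>2 \<le> g * \<mu> * (\<Sum>j = 1..n. (norm (v k j - z))\<^sup>2)"
      using assms(1) by (intro mult_left_mono) auto
    then show "g * \<mu> * (norm (v k i - z))\<^sup>2 \<le> lyapunov n g \<mu> z (y k) (v k)"
      unfolding lyapunov_def using zero_le_power2[of "norm (y k - z)"] by linarith
  qed
qed

subsection \<open>Uniformly sampled indices\<close>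

text \<open>For indicators this is the definition of independence; linearity and monotone limits
  extend it to all nonnegative \<open>N\<close>-measurable functions.\<close>

lemma (in prob_space) nn_integral_indicator_indep:
  assumes sub: "subalgebra M N" and indep: "indep_set (sets N) E"
    and B: "B \<in> E" and f: "f \<in> borel_measurable N"
  shows "(\<integral>\<^sup>+\<omega>. f \<omega> * indicator B \<omega> \<partial>M) = (\<integral>\<^sup>+\<omega>. f \<omega> \<partial>M) * emeasure M B"
proof -
  have BM: "B \<in> sets M"
    using indep B by (auto simp: indep_set_def indep_sets_def split: bool.splits)
  have toM: "g \<in> borel_measurable M" if "g \<in> borel_measurable N" for g :: "'a \<Rightarrow> ennreal"
    using measurable_from_subalg[OF sub that] .
  show ?thesis
    using f
  proof (induction f rule: borel_measurable_induct)
    case (cong f g)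
    have "space N = space M" using sub by (simp add: subalgebra_def)
    then show ?case
      using cong by (simp cong: nn_integral_cong)
  next
    case (set C)
    have CM: "C \<in> sets M" using sub set by (auto simp: subalgebra_def)
    have "(\<integral>\<^sup>+\<omega>. indicator C \<omega> * indicator B \<omega> \<partial>M) = emeasure M (C \<inter> B)"
      using BM CM by (simp flip: indicator_inter_arith)
    also have "\<dots> = emeasure M C * emeasure M B"
      using indep_setD[OF indep set B] by (simp add: emeasure_eq_measure ennreal_mult)
    finally show ?case using CM by simp
  next
    case (mult u c)
    then show ?case
      using BM toM[OF mult(2)] by (simp add: nn_integral_cmult mult.assoc)
  next
    case (add u v)
    then show ?case
      using BM toM[OF add.hyps(1)] toM[OF add.hyps(3)]
      by (simp add: nn_integral_add distrib_right)
  next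
    case (seq U)
    have "(\<integral>\<^sup>+\<omega>. (SUP i. U i) \<omega> * indicator B \<omega> \<partial>M) = (\<integral>\<^sup>+\<omega>. (SUP i. U i \<omega> * indicator B \<omega>) \<partial>M)"
      by (simp add: SUP_mult_right_ennreal image_comp)
    also have "\<dots> = (SUP i. \<integral>\<^sup>+\<omega>. U i \<omega> * indicator B \<omega> \<partial>M)"
      using BM toM[OF seq(1)] seq(3)
      by (intro nn_integral_monotone_convergence_SUP)
        (auto simp: incseq_def le_fun_def intro!: mult_right_mono)
    also have "\<dots> = (SUP i. (\<integral>\<^sup>+\<omega>. U i \<omega> \<partial>M)) * emeasure M B"
      by (simp add: seq SUP_mult_right_ennreal)
    also have "(SUP i. (\<integral>\<^sup>+\<omega>. U i \<omega> \<partial>M)) = (\<integral>\<^sup>+\<omega>. (SUP i. U i) \<omega> \<partial>M)"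
      using toM[OF seq(1)] seq(3) by (simp add: nn_integral_monotone_convergence_SUP image_comp)
    finally show ?case .
  qed
qed

context uniform_sampling
begin

text \<open>On the event that \<open>i\<close> is drawn the integrand is \<open>G i\<close>, which
  depends on the past only and is therefore independent of that event, of probability
  \<open>1 / n\<close>. This takes the place of conditioning on \<open>F k\<close>.\<close>

lemma nn_integral_uniform_index:
  assumes n: "n > 0" and G: "\<And>i. i \<in> {1..n} \<Longrightarrow> G i \<in> borel_measurable (F k)"
  shows "(\<integral>\<^sup>+\<omega>. G (idx k \<omega>) \<omega> \<partial>M) = (\<integral>\<^sup>+\<omega>. ennreal (1 / n) * (\<Sum>i = 1..n. G i \<omega>) \<partial>M)"
proof -
  let ?B = "\<lambda>i. idx k -` {i} \<inter> space M"
  have idx_M: "idx k \<in> measurable M (count_space UNIV)"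
    using measurable_from_subalg[OF subalgebra_F idx_measurable] .
  have B: "?B i \<in> sets M" for i
    using measurable_sets[OF idx_M, of "{i}"] by simp
  have GM: "G i \<in> borel_measurable M" if "i \<in> {1..n}" for i
    using measurable_from_subalg[OF subalgebra_F G[OF that]] .
  have prob: "emeasure M (?B i) = ennreal (1 / n)" if "i \<in> {1..n}" for i
  proof -
    have "emeasure M (?B i) = emeasure (distr M (count_space UNIV) (idx k)) {i}"
      using idx_M by (simp add: emeasure_distr)
    also have "\<dots> = ennreal (1 / n)"
      using that n by (simp add: idx_uniform emeasure_pmf_single indicator_def)
    finally show ?thesis .
  qed
  have "(\<integral>\<^sup>+\<omega>. G (idx k \<omega>) \<omega> \<partial>M) = (\<integral>\<^sup>+\<omega>. (\<Sum>i = 1..n. G i \<omega> * indicator (?B i) \<omega>) \<partial>M)"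
  proof (rule nn_integral_cong)
    fix \<omega> assume w: "\<omega> \<in> space M"
    have "(\<Sum>i = 1..n. G i \<omega> * indicator (?B i) \<omega>) = (\<Sum>i = 1..n. if idx k \<omega> = i then G i \<omega> else 0)"
      using w by (intro sum.cong) (auto simp: indicator_def)
    also have "\<dots> = G (idx k \<omega>) \<omega>"
      using idx_range[OF w, of k] by (subst sum.delta') auto
    finally show "G (idx k \<omega>) \<omega> = (\<Sum>i = 1..n. G i \<omega> * indicator (?B i) \<omega>)" by simp
  qed
  also have "\<dots> = (\<Sum>i = 1..n. \<integral>\<^sup>+\<omega>. G i \<omega> * indicator (?B i) \<omega> \<partial>M)"
    using GM B by (intro nn_integral_sum) auto
  also have "\<dots> = (\<Sum>i = 1..n. (\<integral>\<^sup>+\<omega>. G i \<omega> \<partial>M) * ennreal (1 / n))"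
  proof (intro sum.cong refl)
    fix i assume i: "i \<in> {1..n}"
    show "(\<integral>\<^sup>+\<omega>. G i \<omega> * indicator (?B i) \<omega> \<partial>M) = (\<integral>\<^sup>+\<omega>. G i \<omega> \<partial>M) * ennreal (1 / n)"
      unfolding prob[OF i, symmetric]
      by (rule nn_integral_indicator_indep[OF subalgebra_F idx_indep _ G[OF i]]) auto
  qed
  also have "\<dots> = ennreal (1 / n) * (\<integral>\<^sup>+\<omega>. (\<Sum>i = 1..n. G i \<omega>) \<partial>M)"
    using GM by (subst nn_integral_sum) (auto simp: sum_distrib_right[symmetric] mult.commute)
  also have "\<dots> = (\<integral>\<^sup>+\<omega>. ennreal (1 / n) * (\<Sum>i = 1..n. G i \<omega>) \<partial>M)"
    using GM by (subst nn_integral_cmult) auto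
  finally show ?thesis .
qed

lemma nn_integral_uniform_index_le:
  assumes "n > 0" and "\<And>i. i \<in> {1..n} \<Longrightarrow> G i \<in> borel_measurable (F k)"
    and "\<And>i \<omega>. 0 \<le> (G i \<omega> :: real)"
    and step: "\<And>\<omega>. \<omega> \<in> space M \<Longrightarrow> U \<omega> = G (idx k \<omega>) \<omega>"
    and mean: "\<And>\<omega>. \<omega> \<in> space M \<Longrightarrow> (1 / n) * (\<Sum>i = 1..n. G i \<omega>) \<le> H \<omega>"
  shows "(\<integral>\<^sup>+\<omega>. ennreal (U \<omega>) \<partial>M) \<le> (\<integral>\<^sup>+\<omega>. ennreal (H \<omega>) \<partial>M)"
proof -
  have "(\<integral>\<^sup>+\<omega>. ennreal (U \<omega>) \<partial>M) = (\<integral>\<^sup>+\<omega>. ennreal (G (idx k \<omega>) \<omega>) \<partial>M)"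
    by (intro nn_integral_cong) (simp add: step)
  also have "\<dots> = (\<integral>\<^sup>+\<omega>. ennreal (1 / n) * (\<Sum>i = 1..n. ennreal (G i \<omega>)) \<partial>M)"
    using assms by (intro nn_integral_uniform_index[of "\<lambda>i \<omega>. ennreal (G i \<omega>)"]) auto
  also have "\<dots> \<le> (\<integral>\<^sup>+\<omega>. ennreal (H \<omega>) \<partial>M)"
  proof (rule nn_integral_mono)
    fix \<omega> assume "\<omega> \<in> space M"
    then show "ennreal (1 / n) * (\<Sum>i = 1..n. ennreal (G i \<omega>)) \<le> ennreal (H \<omega>)"
      using mean[of \<omega>] assms(3)
      by (simp add: sum_ennreal sum_nonneg ennreal_leI flip: ennreal_mult)
  qed
  finally show ?thesis .
qed

text \<open>The previous bound is applied to \<open>H - R\<close>. This difference is nonnegative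
  because it dominates a mean of nonnegative terms, so it passes to extended reals without
  truncation.\<close>

lemma nn_integral_uniform_index_descent:
  assumes "n > 0" and "\<And>i. i \<in> {1..n} \<Longrightarrow> G i \<in> borel_measurable (F k)"
    and G0: "\<And>i \<omega>. 0 \<le> (G i \<omega> :: real)"
    and "\<And>\<omega>. \<omega> \<in> space M \<Longrightarrow> U \<omega> = G (idx k \<omega>) \<omega>"
    and mean: "\<And>\<omega>. \<omega> \<in> space M \<Longrightarrow> (1 / n) * (\<Sum>i = 1..n. G i \<omega>) + R \<omega> \<le> H \<omega>"
    and R: "R \<in> borel_measurable M" "\<And>\<omega>. 0 \<le> R \<omega>" and H: "H \<in> borel_measurable M"
  shows "(\<integral>\<^sup>+\<omega>. ennreal (U \<omega>) \<partial>M) + (\<integral>\<^sup>+\<omega>. ennreal (R \<omega>) \<partial>M) \<le> (\<integral>\<^sup>+\<omega>. ennreal (H \<omega>) \<partial>M)"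
proof -
  have mean': "(1 / n) * (\<Sum>i = 1..n. G i \<omega>) \<le> H \<omega> - R \<omega>" if "\<omega> \<in> space M" for \<omega>
    using mean[OF that] by simp
  have "0 \<le> (1 / n) * (\<Sum>i = 1..n. G i \<omega>)" for \<omega>
    using G0 by (simp add: sum_nonneg)
  then have HR: "0 \<le> H \<omega> - R \<omega>" if "\<omega> \<in> space M" for \<omega>
    using mean'[OF that] by (rule order_trans)
  have "(\<integral>\<^sup>+\<omega>. ennreal (U \<omega>) \<partial>M) + (\<integral>\<^sup>+\<omega>. ennreal (R \<omega>) \<partial>M)
      \<le> (\<integral>\<^sup>+\<omega>. ennreal (H \<omega> - R \<omega>) \<partial>M) + (\<integral>\<^sup>+\<omega>. ennreal (R \<omega>) \<partial>M)"
    by (intro add_right_mono nn_integral_uniform_index_le[OF assms(1-4) mean'])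
  also have "\<dots> = (\<integral>\<^sup>+\<omega>. ennreal (H \<omega> - R \<omega>) + ennreal (R \<omega>) \<partial>M)"
    using R H by (intro nn_integral_add[symmetric]) auto
  also have "\<dots> = (\<integral>\<^sup>+\<omega>. ennreal (H \<omega>) \<partial>M)"
    using HR R(2) by (intro nn_integral_cong) (simp flip: ennreal_plus)
  finally show ?thesis .
qed

text \<open>Telescoping bounds the sum of the expectations of the \<open>R k\<close> by the initial
  expectation. Hence the series of the \<open>R k\<close> has finite expectation, converges almost
  surely, and its terms tend to zero.\<close>

lemma AE_tendsto_zero_of_descent:
  fixes U R :: "nat \<Rightarrow> 'w \<Rightarrow> real"
  assumes "\<And>k. U k \<in> borel_measurable M" "\<And>k. R k \<in> borel_measurable M"
    and "\<And>k \<omega>. 0 \<le> U k \<omega>" "\<And>k \<omega>. 0 \<le> R k \<omega>"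
    and init: "(\<integral>\<^sup>+\<omega>. ennreal (U 0 \<omega>) \<partial>M) < \<infinity>"
    and descent: "\<And>k. (\<integral>\<^sup>+\<omega>. ennreal (U (Suc k) \<omega>) \<partial>M) + (\<integral>\<^sup>+\<omega>. ennreal (R k \<omega>) \<partial>M)
      \<le> (\<integral>\<^sup>+\<omega>. ennreal (U k \<omega>) \<partial>M)"
  shows "AE \<omega> in M. (\<lambda>k. R k \<omega>) \<longlonglongrightarrow> 0"
proof -
  have partial: "(\<integral>\<^sup>+\<omega>. ennreal (U N \<omega>) \<partial>M) + (\<Sum>k<N. \<integral>\<^sup>+\<omega>. ennreal (R k \<omega>) \<partial>M)
      \<le> (\<integral>\<^sup>+\<omega>. ennreal (U 0 \<omega>) \<partial>M)" for N
  proof (induction N)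
    case (Suc N)
    have "(\<integral>\<^sup>+\<omega>. ennreal (U (Suc N) \<omega>) \<partial>M) + (\<Sum>k<Suc N. \<integral>\<^sup>+\<omega>. ennreal (R k \<omega>) \<partial>M)
      \<le> (\<integral>\<^sup>+\<omega>. ennreal (U N \<omega>) \<partial>M) + (\<Sum>k<N. \<integral>\<^sup>+\<omega>. ennreal (R k \<omega>) \<partial>M)"
      using add_right_mono[OF descent[of N], of "\<Sum>k<N. \<integral>\<^sup>+\<omega>. ennreal (R k \<omega>) \<partial>M"]
      by (simp add: ac_simps)
    then show ?case using Suc.IH by (rule order_trans)
  qed simp
  have "(\<integral>\<^sup>+\<omega>. (\<Sum>k. ennreal (R k \<omega>)) \<partial>M) = (\<Sum>k. \<integral>\<^sup>+\<omega>. ennreal (R k \<omega>) \<partial>M)"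
    using assms by (intro nn_integral_suminf) auto
  also have "\<dots> = (SUP N. \<Sum>k<N. \<integral>\<^sup>+\<omega>. ennreal (R k \<omega>) \<partial>M)"
    by (rule suminf_eq_SUP)
  also have "\<dots> \<le> (\<integral>\<^sup>+\<omega>. ennreal (U 0 \<omega>) \<partial>M)"
  proof (rule SUP_least)
    fix N
    show "(\<Sum>k<N. \<integral>\<^sup>+\<omega>. ennreal (R k \<omega>) \<partial>M) \<le> (\<integral>\<^sup>+\<omega>. ennreal (U 0 \<omega>) \<partial>M)"
      by (rule order_trans[OF add_increasing[OF zero_le order_refl] partial])
  qed
  finally have "(\<integral>\<^sup>+\<omega>. (\<Sum>k. ennreal (R k \<omega>)) \<partial>M) \<noteq> \<infinity>"
    using init by auto
  then have "AE \<omega> in M. (\<Sum>k. ennreal (R k \<omega>)) \<noteq> \<infinity>"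
    using assms by (intro nn_integral_PInf_AE) auto
  then show ?thesis
  proof eventually_elim
    case (elim \<omega>)
    then have "summable (\<lambda>k. R k \<omega>)"
      using assms by (intro summable_suminf_not_top) auto
    then show ?case by (rule summable_LIMSEQ_zero)
  qed
qed

end

subsection \<open>Point-SAGA\<close>

locale point_saga_solution = point_saga M F n idx A \<gamma> x0 w0 a0 x w a abar h
  for M :: "'w measure" and F :: "nat \<Rightarrow> 'w measure" and n :: nat
    and idx :: "nat \<Rightarrow> 'w \<Rightarrow> nat"
    and A :: "nat \<Rightarrow> 'a \<Rightarrow> 'a::euclidean_space set"
    and \<gamma> :: real
    and x0 :: 'a and w0 :: "nat \<Rightarrow> 'a" and a0 :: "nat \<Rightarrow> 'a"
    and x :: "nat \<Rightarrow> 'w \<Rightarrow> 'a"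
    and w :: "nat \<Rightarrow> nat \<Rightarrow> 'w \<Rightarrow> 'a"
    and a :: "nat \<Rightarrow> nat \<Rightarrow> 'w \<Rightarrow> 'a"
    and abar :: "nat \<Rightarrow> 'w \<Rightarrow> 'a"
    and h :: "nat \<Rightarrow> 'w \<Rightarrow> 'a" +
  fixes \<mu> :: real and xstar :: 'a
  assumes n_pos: "n > 0" and mu_pos: "\<mu> > 0"
    and strong: "\<And>i. i \<in> {1..n} \<Longrightarrow> strongly_max_monotone_op \<mu> (A i)"
    and solution: "0 \<in> avg_op n A xstar"
begin

text \<open>The next iterate if \<open>i\<close> were drawn. Having it for every \<open>i\<close>
  makes averages over the draw explicit and separates the information of \<open>F k\<close> from the
  index \<open>idx k\<close>.\<close>

definition cand :: "nat \<Rightarrow> nat \<Rightarrow> 'w \<Rightarrow> 'a" where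
  "cand k i \<omega> = resolvent_or xstar \<gamma> (A i) (x k \<omega> + \<gamma> *\<^sub>R (a k i \<omega> - abar k \<omega>))"

lemma gamma_mu_pos: "\<gamma> * \<mu> > 0"
  using stepsize_pos mu_pos by simp

lemma max_monotone: "i \<in> {1..n} \<Longrightarrow> max_monotone_op (A i)"
  using strong by (simp add: strongly_max_monotone_op_def)

lemma x_Suc:
  assumes "\<omega> \<in> space M"
  shows "x (Suc k) \<omega> = cand k (idx k \<omega>) \<omega>"
  using max_monotone[OF idx_range[OF assms]] stepsize_pos x_step[OF assms, of k] h_step[OF assms]
  unfolding cand_def by (intro resolvent_or_eqI[symmetric]) (auto simp: max_monotone_op_def)

lemma w_Suc:
  assumes "\<omega> \<in> space M" "j \<in> {1..n}"
  shows "w (Suc k) j \<omega> = ((\<lambda>j. w k j \<omega>)(idx k \<omega> := cand k (idx k \<omega>) \<omega>)) j"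
  using w_step[OF assms(1)] w_keep[OF assms] x_Suc[OF assms(1)] by auto

text \<open>An element and its point are always replaced together. Average similarity can thus be
  applied to the stored elements with the points \<open>w k i\<close>.\<close>

lemma a_mem:
  assumes "\<omega> \<in> space M" "i \<in> {1..n}"
  shows "a k i \<omega> \<in> A i (w k i \<omega>)"
proof (induction k)
  case 0
  show ?case using assms by (simp add: a_init w_init a0_mem)
next
  case (Suc k)
  show ?case
    using Suc a_step[OF assms(1), of k] w_step[OF assms(1), of k]
      a_keep[OF assms, of k] w_keep[OF assms, of k] by (cases "i = idx k \<omega>") auto
qed

text \<open>Only one entry changes, and the recursion adds exactly its increment divided by
  \<open>n\<close>.\<close>

lemma abar_eq_avg:
  assumes "\<omega> \<in> space M"
  shows "abar k \<omega> = avg n (\<lambda>i. a k i \<omega>)"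
proof (induction k)
  case 0
  show ?case using assms by (auto simp: abar_init avg_def a_init intro!: sum.cong)
next
  case (Suc k)
  let ?i = "idx k \<omega>"
  have i: "?i \<in> {1..n}" using idx_range[OF assms] .
  have "(\<Sum>j = 1..n. a (Suc k) j \<omega>) = a (Suc k) ?i \<omega> + (\<Sum>j \<in> {1..n} - {?i}. a k j \<omega>)"
    using i a_keep[OF assms] by (subst sum.remove[of _ ?i]) auto
  also have "\<dots> = (\<Sum>j = 1..n. a k j \<omega>) + (a (Suc k) ?i \<omega> - a k ?i \<omega>)"
    using i by (simp add: sum.remove[of _ ?i])
  finally show ?case
    by (simp add: abar_step[OF assms] Suc avg_def scaleR_right_distrib)
qed

section \<open>Measurability of the iterates with respect to the filtration\<close>

lemma space_F: "space (F k) = space M"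
  using subalgebra_F[of k] by (simp add: subalgebra_def)

lemma measurable_F_Suc:
  assumes "f \<in> measurable (F k) N"
  shows "f \<in> measurable (F (Suc k)) N"
proof (rule measurable_from_subalg[OF _ assms])
  show "subalgebra (F (Suc k)) (F k)"
    using sets_F_mono[of k "Suc k"] by (simp add: subalgebra_def space_F)
qed

lemma measurable_F_cong:
  assumes "g \<in> measurable (F k) N" "\<And>\<omega>. \<omega> \<in> space M \<Longrightarrow> f \<omega> = g \<omega>"
  shows "f \<in> measurable (F k) N"
  using assms(1) measurable_cong[of "F k" f g N] assms(2) by (simp add: space_F)

lemma measurable_F_M: "f \<in> measurable (F k) N \<Longrightarrow> f \<in> measurable M N"
  by (rule measurable_from_subalg[OF subalgebra_F])

lemma abar_measurable: "abar k \<in> borel_measurable (F k)"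
proof -
  have "(\<lambda>\<omega>. avg n (\<lambda>i. a k i \<omega>)) \<in> borel_measurable (F k)"
    unfolding avg_def using a_adapted by (intro borel_measurable_scaleR borel_measurable_sum) auto
  then show ?thesis
    using abar_eq_avg by (rule measurable_F_cong)
qed

text \<open>Measurability of \<open>x k\<close> is a premise because it is itself obtained by
  induction through the candidates.\<close>

lemma cand_measurable_of_x:
  assumes "x k \<in> borel_measurable (F k)" "i \<in> {1..n}"
  shows "cand k i \<in> borel_measurable (F k)"
  unfolding cand_def
  using assms a_adapted abar_measurable[of k]
  by (intro measurable_compose[OF _ borel_measurable_resolvent_or[OF max_monotone stepsize_pos]]
      borel_measurable_add borel_measurable_scaleR borel_measurable_diff) auto

lemma x_measurable: "x k \<in> borel_measurable (F k)"
proof (induction k)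
  case 0
  have "(\<lambda>\<omega>. x0) \<in> borel_measurable (F 0)" by simp
  then show ?case
    using x_init by (rule measurable_F_cong)
next
  case (Suc k)
  \<comment> \<open>Composition with \<open>idx k\<close> asks for measurability at every natural
    number, so a constant stands in outside \<open>{1..n}\<close>.\<close>
  let ?c = "\<lambda>i. if i \<in> {1..n} then cand k i else (\<lambda>_. xstar)"
  have "(\<lambda>\<omega>. ?c (idx k \<omega>) \<omega>) \<in> borel_measurable (F (Suc k))"
  proof (rule measurable_compose_countable[OF _ idx_measurable])
    show "?c i \<in> borel_measurable (F (Suc k))" for i
      using measurable_F_Suc[OF cand_measurable_of_x[OF Suc]] by (cases "i \<in> {1..n}") auto
  qed
  moreover have "x (Suc k) \<omega> = ?c (idx k \<omega>) \<omega>" if "\<omega> \<in> space M" for \<omega>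
    using that idx_range[of \<omega> k] by (simp add: x_Suc)
  ultimately show ?case
    by (rule measurable_F_cong)
qed

lemma cand_measurable: "i \<in> {1..n} \<Longrightarrow> cand k i \<in> borel_measurable (F k)"
  by (rule cand_measurable_of_x[OF x_measurable])

lemma w_measurable:
  assumes "i \<in> {1..n}"
  shows "w k i \<in> borel_measurable (F k)"
proof (induction k)
  case 0
  have "(\<lambda>\<omega>. w0 i) \<in> borel_measurable (F 0)" by simp
  then show ?case
    using w_init[OF _ assms] by (rule measurable_F_cong)
next
  case (Suc k)
  have "{\<omega> \<in> space (F (Suc k)). idx k \<omega> = i} \<in> sets (F (Suc k))"
    using measurable_sets[OF idx_measurable[of k], of "{i}"] by (simp add: vimage_def Int_def conj_commute)
  then have "(\<lambda>\<omega>. if idx k \<omega> = i then x (Suc k) \<omega> else w k i \<omega>) \<in> borel_measurable (F (Suc k))"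
    by (intro measurable_If measurable_F_Suc[OF Suc] x_measurable)
  moreover have "w (Suc k) i \<omega> = (if idx k \<omega> = i then x (Suc k) \<omega> else w k i \<omega>)"
    if "\<omega> \<in> space M" for \<omega>
    using that assms w_step w_keep by auto
  ultimately show ?case
    by (rule measurable_F_cong)
qed

text \<open>The weight \<open>g\<close> is left free: \<open>\<gamma>\<close> gives the Lyapunov
  function of the linear rate, \<open>2 * \<gamma>\<close> the potential that decreases strictly
  whenever the rate is at most 1.\<close>

definition energy :: "real \<Rightarrow> nat \<Rightarrow> 'w \<Rightarrow> real" where
  "energy g k \<omega> = lyapunov n g \<mu> xstar (x k \<omega>) (\<lambda>i. w k i \<omega>)"

text \<open>The value of \<open>energy g\<close> after the step in which \<open>i\<close> is
  drawn.\<close>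

definition energy_cand :: "real \<Rightarrow> nat \<Rightarrow> nat \<Rightarrow> 'w \<Rightarrow> real" where
  "energy_cand g k i \<omega> =
     lyapunov n g \<mu> xstar (cand k i \<omega>) ((\<lambda>j. w k j \<omega>)(i := cand k i \<omega>))"

lemma energy_nonneg: "0 \<le> g \<Longrightarrow> 0 \<le> energy g k \<omega>"
  using mu_pos by (simp add: energy_def lyapunov_nonneg)

lemma energy_cand_nonneg: "0 \<le> g \<Longrightarrow> 0 \<le> energy_cand g k i \<omega>"
  using mu_pos by (simp add: energy_cand_def lyapunov_nonneg)

lemma energy_mono: "0 \<le> g \<Longrightarrow> g \<le> g' \<Longrightarrow> energy g k \<omega> \<le> energy g' k \<omega>"
  using mu_pos by (auto simp: energy_def lyapunov_def intro!: mult_right_mono sum_nonneg)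

lemma energy_Suc:
  assumes "\<omega> \<in> space M"
  shows "energy g (Suc k) \<omega> = energy_cand g k (idx k \<omega>) \<omega>"
  unfolding energy_def energy_cand_def lyapunov_def x_Suc[OF assms]
  using w_Suc[OF assms, of _ k] by simp

lemma energy_init: "\<omega> \<in> space M \<Longrightarrow> energy g 0 \<omega> = lyapunov n g \<mu> xstar x0 w0"
  by (simp add: energy_def lyapunov_def x_init w_init)

lemma energy_measurable: "energy g k \<in> borel_measurable (F k)"
  unfolding energy_def lyapunov_def
  by (intro borel_measurable_add borel_measurable_times borel_measurable_norm_diff_sq
      borel_measurable_const borel_measurable_sum x_measurable w_measurable)

lemma energy_cand_measurable:
  assumes i: "i \<in> {1..n}"
  shows "energy_cand g k i \<in> borel_measurable (F k)"
proof -
  have "(\<lambda>\<omega>. ((\<lambda>j. w k j \<omega>)(i := cand k i \<omega>)) j) \<in> borel_measurable (F k)" if "j \<in> {1..n}" for j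
    using cand_measurable[OF i] w_measurable[OF that] by (cases "j = i") auto
  then show ?thesis
    unfolding energy_cand_def lyapunov_def
    by (intro borel_measurable_add borel_measurable_times borel_measurable_norm_diff_sq
        borel_measurable_const borel_measurable_sum cand_measurable[OF i])
qed

section \<open>Mean of the Lyapunov function after one step\<close>

lemma sum_energy_cand:
  "(\<Sum>i = 1..n. energy_cand g k i \<omega>)
     = (1 + g * \<mu>) * (\<Sum>i = 1..n. (norm (cand k i \<omega> - xstar))\<^sup>2)
       + g * \<mu> * (real n - 1) * (\<Sum>i = 1..n. (norm (w k i \<omega> - xstar))\<^sup>2)"
  unfolding energy_cand_def
  by (rule sum_lyapunov_fun_upd[where v = "\<lambda>j. w k j \<omega>" and p = "\<lambda>i. cand k i \<omega>"])

text \<open>The arguments of the resolvents differ from \<open>x k \<omega> - xstar\<close> by a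
  centered family, since the deviations from the average and the \<open>astar i\<close> both sum to
  zero. The bias-variance decomposition then applies.\<close>

lemma sum_norm_prox_argument:
  assumes "\<omega> \<in> space M" and "(\<Sum>i = 1..n. astar i) = 0"
  shows "(\<Sum>i = 1..n. (norm (x k \<omega> + \<gamma> *\<^sub>R (a k i \<omega> - abar k \<omega>) - \<gamma> *\<^sub>R astar i - xstar))\<^sup>2)
    = n * (norm (x k \<omega> - xstar))\<^sup>2
      + \<gamma>\<^sup>2 * (\<Sum>i = 1..n. (norm (a k i \<omega> - abar k \<omega> - astar i))\<^sup>2)"
proof -
  let ?b = "\<lambda>i. \<gamma> *\<^sub>R (a k i \<omega> - abar k \<omega> - astar i)"
  have "(\<Sum>i = 1..n. a k i \<omega> - abar k \<omega> - astar i) = 0"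
    using sum_diff_avg[OF n_pos, of "\<lambda>i. a k i \<omega>"] assms by (simp add: sum_subtractf abar_eq_avg)
  then have "(\<Sum>i = 1..n. ?b i) = 0"
    by (simp flip: scaleR_sum_right)
  from sum_norm_shift_centered[OF this, of "x k \<omega> - xstar"]
  have "(\<Sum>i = 1..n. (norm (x k \<omega> - xstar + ?b i))\<^sup>2) = n * (norm (x k \<omega> - xstar))\<^sup>2
      + \<gamma>\<^sup>2 * (\<Sum>i = 1..n. (norm (a k i \<omega> - abar k \<omega> - astar i))\<^sup>2)"
    by (simp add: power_mult_distrib sum_distrib_left)
  moreover have arg: "x k \<omega> + \<gamma> *\<^sub>R (a k i \<omega> - abar k \<omega>) - \<gamma> *\<^sub>R astar i - xstar = x k \<omega> - xstar + ?b i" for i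
    by (simp add: algebra_simps)
  ultimately show ?thesis unfolding arg by blast
qed

text \<open>Each candidate contracts towards the solution, and average similarity bounds the spread
  of the arguments. The elements \<open>astar i\<close> may vary with \<open>k\<close> and
  \<open>\<omega>\<close>, as the estimate is pointwise.\<close>

lemma sum_norm_cand_le:
  assumes sim: "average_similarity n A xstar \<delta>" and \<omega>: "\<omega> \<in> space M"
  shows "(1 + \<gamma> * \<mu>)\<^sup>2 * (\<Sum>i = 1..n. (norm (cand k i \<omega> - xstar))\<^sup>2)
    \<le> n * (norm (x k \<omega> - xstar))\<^sup>2 + \<gamma>\<^sup>2 * \<delta>\<^sup>2 * (\<Sum>i = 1..n. (norm (w k i \<omega> - xstar))\<^sup>2)"
proof -
  obtain astar where astar: "\<And>i. i \<in> {1..n} \<Longrightarrow> astar i \<in> A i xstar" "(\<Sum>i = 1..n. astar i) = 0"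
    and le: "(1 / real n) * (\<Sum>i = 1..n. (norm (a k i \<omega> - abar k \<omega> - astar i))\<^sup>2)
             \<le> (\<delta>\<^sup>2 / real n) * (\<Sum>i = 1..n. (norm (w k i \<omega> - xstar))\<^sup>2)"
    using sim[unfolded average_similarity_def, rule_format,
        of "\<lambda>i. a k i \<omega>" "\<lambda>i. w k i \<omega>"] a_mem[OF \<omega>, of _ k]
    unfolding abar_eq_avg[OF \<omega>] by blast
  have le': "(\<Sum>i = 1..n. (norm (a k i \<omega> - abar k \<omega> - astar i))\<^sup>2)
             \<le> \<delta>\<^sup>2 * (\<Sum>i = 1..n. (norm (w k i \<omega> - xstar))\<^sup>2)"
    using le n_pos by (simp add: divide_le_cancel)
  have "(1 + \<gamma> * \<mu>)\<^sup>2 * (\<Sum>i = 1..n. (norm (cand k i \<omega> - xstar))\<^sup>2)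
      \<le> (\<Sum>i = 1..n. (norm (x k \<omega> + \<gamma> *\<^sub>R (a k i \<omega> - abar k \<omega>) - \<gamma> *\<^sub>R astar i - xstar))\<^sup>2)"
    unfolding sum_distrib_left cand_def
    by (intro sum_mono resolvent_or_contraction strong stepsize_pos astar mu_pos)
  also have "\<dots> = n * (norm (x k \<omega> - xstar))\<^sup>2
      + \<gamma>\<^sup>2 * (\<Sum>i = 1..n. (norm (a k i \<omega> - abar k \<omega> - astar i))\<^sup>2)"
    by (rule sum_norm_prox_argument[OF \<omega> astar(2)])
  finally show ?thesis
    using mult_left_mono[OF le', of "\<gamma>\<^sup>2"] by (simp add: mult.assoc)
qed

text \<open>The mean is bounded by a combination of \<open>D\<close> and \<open>W\<close>, and the
  premises on \<open>c\<close> compare its two coefficients with those of \<open>energy g\<close>.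
  The factor \<open>q\<close> is the total weight \<open>1 + g * \<mu>\<close> of a new point
  divided by the contraction factor.\<close>

lemma mean_energy_cand_le:
  assumes sim: "average_similarity n A xstar \<delta>" and \<omega>: "\<omega> \<in> space M" and g: "g \<ge> 0"
    and c1: "(1 + g * \<mu>) / (1 + \<gamma> * \<mu>)\<^sup>2 \<le> c"
    and c2: "(1 + g * \<mu>) / (1 + \<gamma> * \<mu>)\<^sup>2 * (\<gamma>\<^sup>2 * \<delta>\<^sup>2 / n) + g * \<mu> * (1 - 1 / n) \<le> c * (g * \<mu>)"
  shows "(1 / n) * (\<Sum>i = 1..n. energy_cand g k i \<omega>) \<le> c * energy g k \<omega>"
proof -
  define D W d where "D = (norm (x k \<omega> - xstar))\<^sup>2"
    and "W = (\<Sum>i = 1..n. (norm (w k i \<omega> - xstar))\<^sup>2)"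
    and "d = (\<Sum>i = 1..n. (norm (cand k i \<omega> - xstar))\<^sup>2)"
  define q where "q = (1 + g * \<mu>) / (1 + \<gamma> * \<mu>)\<^sup>2"
  have nonneg: "0 \<le> D" "0 \<le> W" by (auto simp: D_def W_def sum_nonneg)
  have pos: "0 < (1 + \<gamma> * \<mu>)\<^sup>2" "0 \<le> 1 + g * \<mu>"
    using gamma_mu_pos g mu_pos by auto
  have "(1 + \<gamma> * \<mu>)\<^sup>2 * d \<le> n * D + \<gamma>\<^sup>2 * \<delta>\<^sup>2 * W"
    unfolding D_def W_def d_def by (rule sum_norm_cand_le[OF sim \<omega>])
  then have "q * ((1 + \<gamma> * \<mu>)\<^sup>2 * d) \<le> q * (n * D + \<gamma>\<^sup>2 * \<delta>\<^sup>2 * W)"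
    using pos by (intro mult_left_mono) (auto simp: q_def)
  then have d: "(1 + g * \<mu>) * d \<le> q * (n * D + \<gamma>\<^sup>2 * \<delta>\<^sup>2 * W)"
    using pos by (simp add: q_def)
  have "(1 / n) * (\<Sum>i = 1..n. energy_cand g k i \<omega>)
      = (1 / n) * ((1 + g * \<mu>) * d + g * \<mu> * (real n - 1) * W)"
    unfolding sum_energy_cand D_def W_def d_def ..
  also have "\<dots> \<le> (1 / n) * (q * (n * D + \<gamma>\<^sup>2 * \<delta>\<^sup>2 * W) + g * \<mu> * (real n - 1) * W)"
    using d by (intro mult_left_mono add_right_mono) auto
  also have "\<dots> = q * D + (q * (\<gamma>\<^sup>2 * \<delta>\<^sup>2 / n) + g * \<mu> * (1 - 1 / n)) * W"
    using n_pos by (simp add: field_simps)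
  also have "\<dots> \<le> c * D + (c * (g * \<mu>)) * W"
    using c1 c2 nonneg unfolding q_def by (intro add_mono mult_right_mono) auto
  also have "\<dots> = c * energy g k \<omega>"
    by (simp add: energy_def lyapunov_def D_def W_def algebra_simps)
  finally show ?thesis .
qed

text \<open>Common end of the convergence proofs: any nonnegative potential with a constant initial
  value will do if its expected decrease dominates a positive multiple of the Lyapunov
  function.\<close>

lemma AE_converges_of_descent:
  fixes U :: "nat \<Rightarrow> 'w \<Rightarrow> real"
  assumes "\<And>k. U k \<in> borel_measurable M" "\<And>k \<omega>. 0 \<le> U k \<omega>"
    and "\<And>\<omega>. \<omega> \<in> space M \<Longrightarrow> U 0 \<omega> = u0" and \<epsilon>: "\<epsilon> > 0"
    and descent: "\<And>k. (\<integral>\<^sup>+\<omega>. ennreal (U (Suc k) \<omega>) \<partial>M) + (\<integral>\<^sup>+\<omega>. ennreal (\<epsilon> * energy \<gamma> k \<omega>) \<partial>M)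
      \<le> (\<integral>\<^sup>+\<omega>. ennreal (U k \<omega>) \<partial>M)"
  shows "AE \<omega> in M. (\<lambda>k. x k \<omega>) \<longlonglongrightarrow> xstar \<and> (\<forall>i \<in> {1..n}. (\<lambda>k. w k i \<omega>) \<longlonglongrightarrow> xstar)"
proof -
  have "(\<integral>\<^sup>+\<omega>. ennreal (U 0 \<omega>) \<partial>M) = (\<integral>\<^sup>+\<omega>. ennreal u0 \<partial>M)"
    using assms(3) by (intro nn_integral_cong) simp
  then have "(\<integral>\<^sup>+\<omega>. ennreal (U 0 \<omega>) \<partial>M) < \<infinity>"
    by (simp add: emeasure_space_1)
  moreover have "(\<lambda>\<omega>. \<epsilon> * energy \<gamma> k \<omega>) \<in> borel_measurable M" for k
    using measurable_F_M[OF energy_measurable] by simp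
  moreover have "0 \<le> \<epsilon> * energy \<gamma> k \<omega>" for k \<omega>
    using \<epsilon> stepsize_pos energy_nonneg by simp
  ultimately have "AE \<omega> in M. (\<lambda>k. \<epsilon> * energy \<gamma> k \<omega>) \<longlonglongrightarrow> 0"
    using assms(1,2) descent by (intro AE_tendsto_zero_of_descent[of U])
  then show ?thesis
  proof eventually_elim
    case (elim \<omega>)
    then have "(\<lambda>k. (1 / \<epsilon>) * (\<epsilon> * energy \<gamma> k \<omega>)) \<longlonglongrightarrow> (1 / \<epsilon>) * 0"
      by (intro tendsto_mult_left)
    then have "(\<lambda>k. energy \<gamma> k \<omega>) \<longlonglongrightarrow> 0"
      using \<epsilon> by simp
    then have "(\<lambda>k. lyapunov n \<gamma> \<mu> xstar (x k \<omega>) (\<lambda>i. w k i \<omega>)) \<longlonglongrightarrow> 0"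
      unfolding energy_def .
    from lyapunov_tendsto_zeroD[OF gamma_mu_pos this] show ?case by blast
  qed
qed

section \<open>Linear bound on the expected Lyapunov function\<close>

text \<open>For \<open>g = \<gamma>\<close> the factor \<open>q\<close> is
  \<open>1 / (1 + \<gamma> * \<mu>)\<close>, and the two conditions on \<open>c\<close> become the
  two entries of the maximum in \<open>rate\<close>. Nonnegative integrals let the induction run
  before integrability is known.\<close>

lemma nn_integral_energy_le:
  assumes sim: "average_similarity n A xstar \<delta>"
  shows "(\<integral>\<^sup>+\<omega>. ennreal (energy \<gamma> k \<omega>) \<partial>M)
    \<le> ennreal (rate n \<gamma> \<mu> \<delta> ^ k * lyapunov n \<gamma> \<mu> xstar x0 w0)"
proof (induction k)
  case 0
  have "(\<integral>\<^sup>+\<omega>. ennreal (energy \<gamma> 0 \<omega>) \<partial>M) = (\<integral>\<^sup>+\<omega>. ennreal (lyapunov n \<gamma> \<mu> xstar x0 w0) \<partial>M)"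
    by (intro nn_integral_cong) (simp add: energy_init)
  then show ?case by (simp add: emeasure_space_1)
next
  case (Suc k)
  define s where "s = \<gamma> * \<mu>"
  let ?c = "rate n \<gamma> \<mu> \<delta>"
  have s: "s > 0" using gamma_mu_pos by (simp add: s_def)
  have c0: "?c \<ge> 0" using s by (auto simp: rate_def s_def le_max_iff_disj)
  have q: "(1 + s) / (1 + s)\<^sup>2 = 1 / (1 + s)"
    using s by (simp add: power2_eq_square)
  have c1: "(1 + \<gamma> * \<mu>) / (1 + \<gamma> * \<mu>)\<^sup>2 \<le> ?c"
    using q by (simp add: rate_def s_def)
  have "(1 + s) / (1 + s)\<^sup>2 * (\<gamma>\<^sup>2 * \<delta>\<^sup>2 / n) + s * (1 - 1 / n)
      = (1 - 1 / n + \<gamma> * \<delta>\<^sup>2 / (n * \<mu> * (1 + s))) * s"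
  proof -
    \<comment> \<open>A general \<open>t\<close> keeps the factor \<open>1 + s\<close>
      unexpanded.\<close>
    have "\<gamma> * \<delta>\<^sup>2 / (n * \<mu> * t) * (\<gamma> * \<mu>) = 1 / t * (\<gamma>\<^sup>2 * \<delta>\<^sup>2 / n)" for t
      using mu_pos n_pos by (cases "t = 0") (auto simp: field_simps power2_eq_square)
    from this[of "1 + s", folded s_def] show ?thesis
      unfolding q by (simp add: algebra_simps)
  qed
  also have "\<dots> \<le> ?c * s"
    using s by (intro mult_right_mono) (auto simp: rate_def s_def)
  finally have c2: "(1 + \<gamma> * \<mu>) / (1 + \<gamma> * \<mu>)\<^sup>2 * (\<gamma>\<^sup>2 * \<delta>\<^sup>2 / n) + \<gamma> * \<mu> * (1 - 1 / n)
      \<le> ?c * (\<gamma> * \<mu>)"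
    by (simp add: s_def)
  have "(\<integral>\<^sup>+\<omega>. ennreal (energy \<gamma> (Suc k) \<omega>) \<partial>M) \<le> (\<integral>\<^sup>+\<omega>. ennreal (?c * energy \<gamma> k \<omega>) \<partial>M)"
  proof (rule nn_integral_uniform_index_le[OF n_pos energy_cand_measurable[of _ \<gamma> k]])
    have g: "0 \<le> \<gamma>" using stepsize_pos by simp
    show "0 \<le> energy_cand \<gamma> k i \<omega>" for i \<omega> by (rule energy_cand_nonneg[OF g])
    fix \<omega> assume \<omega>: "\<omega> \<in> space M"
    show "energy \<gamma> (Suc k) \<omega> = energy_cand \<gamma> k (idx k \<omega>) \<omega>" by (rule energy_Suc[OF \<omega>])
    show "(1 / n) * (\<Sum>i = 1..n. energy_cand \<gamma> k i \<omega>) \<le> ?c * energy \<gamma> k \<omega>"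
      by (rule mean_energy_cand_le[OF sim \<omega> g c1 c2])
  qed
  also have "\<dots> = ennreal ?c * (\<integral>\<^sup>+\<omega>. ennreal (energy \<gamma> k \<omega>) \<partial>M)"
    using c0 measurable_F_M[OF energy_measurable] energy_nonneg stepsize_pos
    by (simp add: ennreal_mult nn_integral_cmult)
  also have "\<dots> \<le> ennreal ?c * ennreal (?c ^ k * lyapunov n \<gamma> \<mu> xstar x0 w0)"
    using Suc by (intro mult_left_mono) auto
  also have "\<dots> = ennreal (?c ^ Suc k * lyapunov n \<gamma> \<mu> xstar x0 w0)"
    using c0 stepsize_pos mu_pos by (simp add: lyapunov_nonneg mult.assoc flip: ennreal_mult)
  finally show ?case .
qed

lemma
  assumes sim: "average_similarity n A xstar \<delta>"
  shows integrable_energy: "integrable M (energy \<gamma> k)"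
    and integral_energy_le:
      "(\<integral>\<omega>. energy \<gamma> k \<omega> \<partial>M) \<le> rate n \<gamma> \<mu> \<delta> ^ k * lyapunov n \<gamma> \<mu> xstar x0 w0"
proof -
  have nonneg: "0 \<le> energy \<gamma> k \<omega>" for \<omega>
    using stepsize_pos by (simp add: energy_nonneg)
  have "0 \<le> rate n \<gamma> \<mu> \<delta>"
    using gamma_mu_pos by (auto simp: rate_def le_max_iff_disj)
  then have bound: "0 \<le> rate n \<gamma> \<mu> \<delta> ^ k * lyapunov n \<gamma> \<mu> xstar x0 w0"
    using stepsize_pos mu_pos by (simp add: lyapunov_nonneg)
  show int: "integrable M (energy \<gamma> k)"
    using nn_integral_energy_le[OF sim, of k] nonneg
    by (intro integrableI_nonneg measurable_F_M[OF energy_measurable])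
      (auto intro: order_le_less_trans)
  then have "ennreal (\<integral>\<omega>. energy \<gamma> k \<omega> \<partial>M) = (\<integral>\<^sup>+\<omega>. ennreal (energy \<gamma> k \<omega>) \<partial>M)"
    using nonneg by (intro nn_integral_eq_integral[symmetric]) auto
  then show "(\<integral>\<omega>. energy \<gamma> k \<omega> \<partial>M) \<le> rate n \<gamma> \<mu> \<delta> ^ k * lyapunov n \<gamma> \<mu> xstar x0 w0"
    using nn_integral_energy_le[OF sim, of k] bound by (metis ennreal_le_iff)
qed

section \<open>Almost sure convergence\<close>

text \<open>The Lyapunov function of the linear rate need not decrease strictly when the rate is \<open>1\<close>.
  Doubling the weight of the \<open>w\<close> part makes both of its coefficients contract strictly.\<close>

lemma AE_converges_of_rate_le_1:
  assumes sim: "average_similarity n A xstar \<delta>" and rate: "rate n \<gamma> \<mu> \<delta> \<le> 1"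
  shows "AE \<omega> in M. (\<lambda>k. x k \<omega>) \<longlonglongrightarrow> xstar \<and> (\<forall>i \<in> {1..n}. (\<lambda>k. w k i \<omega>) \<longlonglongrightarrow> xstar)"
proof -
  define s where "s = \<gamma> * \<mu>"
  have s: "s > 0" using gamma_mu_pos by (simp add: s_def)
  have n: "real n > 0" using n_pos by simp
  \<comment> \<open>The second entry of the maximum in \<open>rate\<close> is at most 1.\<close>
  have "\<gamma> * \<delta>\<^sup>2 / (n * \<mu> * (1 + s)) \<le> 1 / n"
    using rate by (simp add: rate_def s_def)
  then have "\<gamma> * \<delta>\<^sup>2 \<le> 1 / n * (n * \<mu> * (1 + s))"
    using n s mu_pos by (subst (asm) pos_divide_le_eq) auto
  then have "\<gamma> * \<delta>\<^sup>2 \<le> \<mu> * (1 + s)"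
    using n by simp
  then have "\<gamma> * (\<gamma> * \<delta>\<^sup>2) \<le> \<gamma> * (\<mu> * (1 + s))"
    using stepsize_pos by (intro mult_left_mono) auto
  then have gd: "\<gamma>\<^sup>2 * \<delta>\<^sup>2 \<le> s * (1 + s)"
    by (simp add: s_def power2_eq_square mult.assoc)
  \<comment> \<open>The entries are the contraction factors of the two coefficients of
    \<open>energy (2 * \<gamma>)\<close>. The first is below 1 because
    \<open>(1 + s)\<^sup>2\<close> exceeds \<open>1 + 2 * s\<close> by
    \<open>s\<^sup>2\<close>.\<close>
  define c where "c = max ((1 + 2 * s) / (1 + s)\<^sup>2) (1 - 1 / (2 * n * (1 + s)))"
  have "(1 + 2 * s) / (1 + s)\<^sup>2 < 1"
    using s by (simp add: power2_eq_square algebra_simps add_pos_pos)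
  then have c_lt: "c < 1"
    using s n by (simp add: c_def)
  have c1: "(1 + 2 * \<gamma> * \<mu>) / (1 + \<gamma> * \<mu>)\<^sup>2 \<le> c"
    by (simp add: c_def s_def mult.assoc)
  have "(1 + 2 * s) / (1 + s)\<^sup>2 * (\<gamma>\<^sup>2 * \<delta>\<^sup>2 / n) + 2 * s * (1 - 1 / n)
      \<le> (1 + 2 * s) / (1 + s)\<^sup>2 * (s * (1 + s) / n) + 2 * s * (1 - 1 / n)"
    using gd s n by (intro add_right_mono mult_left_mono divide_right_mono) auto
  also have "\<dots> = (1 - 1 / (2 * n * (1 + s))) * (2 * s)"
  proof -
    \<comment> \<open>With \<open>t = 1 + s\<close>, the numerator \<open>1 + 2 * s\<close> is
      \<open>2 * t - 1\<close>.\<close>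
    have "(2 * t - 1) / t\<^sup>2 * (s * t / n) + 2 * s * (1 - 1 / n) = (1 - 1 / (2 * n * t)) * (2 * s)"
      if "t > 0" for t :: real
      using that n by (simp add: field_simps power2_eq_square)
    from this[of "1 + s"] s show ?thesis by simp
  qed
  also have "\<dots> \<le> c * (2 * s)"
    using s by (intro mult_right_mono) (auto simp: c_def)
  finally have c2: "(1 + 2 * \<gamma> * \<mu>) / (1 + \<gamma> * \<mu>)\<^sup>2 * (\<gamma>\<^sup>2 * \<delta>\<^sup>2 / n) + 2 * \<gamma> * \<mu> * (1 - 1 / n)
      \<le> c * (2 * \<gamma> * \<mu>)"
    by (simp add: s_def mult.assoc)
  have g0: "0 \<le> 2 * \<gamma>" using stepsize_pos by simp
  show ?thesis
  proof (rule AE_converges_of_descent[of "energy (2 * \<gamma>)" _ "1 - c"])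
    show "0 < 1 - c" using c_lt by simp
    show "energy (2 * \<gamma>) k \<in> borel_measurable M" for k
      by (rule measurable_F_M[OF energy_measurable])
    show "0 \<le> energy (2 * \<gamma>) k \<omega>" for k \<omega> by (rule energy_nonneg[OF g0])
    show "energy (2 * \<gamma>) 0 \<omega> = lyapunov n (2 * \<gamma>) \<mu> xstar x0 w0" if "\<omega> \<in> space M" for \<omega>
      by (rule energy_init[OF that])
    fix k
    show "(\<integral>\<^sup>+\<omega>. ennreal (energy (2 * \<gamma>) (Suc k) \<omega>) \<partial>M)
        + (\<integral>\<^sup>+\<omega>. ennreal ((1 - c) * energy \<gamma> k \<omega>) \<partial>M) \<le> (\<integral>\<^sup>+\<omega>. ennreal (energy (2 * \<gamma>) k \<omega>) \<partial>M)"
    proof (rule nn_integral_uniform_index_descent[OF n_pos energy_cand_measurable[of _ "2 * \<gamma>" k]])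
      fix \<omega> assume \<omega>: "\<omega> \<in> space M"
      \<comment> \<open>The decrease is a multiple of the energy with weight
        \<open>2 * \<gamma>\<close>, which dominates the one with weight
        \<open>\<gamma>\<close>.\<close>
      have "(1 - c) * energy \<gamma> k \<omega> \<le> (1 - c) * energy (2 * \<gamma>) k \<omega>"
        using c_lt stepsize_pos by (intro mult_left_mono energy_mono) auto
      with mean_energy_cand_le[OF sim \<omega> g0 c1 c2, of k]
      show "(1 / n) * (\<Sum>i = 1..n. energy_cand (2 * \<gamma>) k i \<omega>) + (1 - c) * energy \<gamma> k \<omega>
          \<le> energy (2 * \<gamma>) k \<omega>"
        by (simp add: algebra_simps)
    next
      show "(\<lambda>\<omega>. (1 - c) * energy \<gamma> k \<omega>) \<in> borel_measurable M"
        by (intro borel_measurable_times borel_measurable_const measurable_F_M[OF energy_measurable])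
      show "0 \<le> (1 - c) * energy \<gamma> k \<omega>" for \<omega>
        using c_lt stepsize_pos by (intro mult_nonneg_nonneg energy_nonneg) auto
      show "energy (2 * \<gamma>) k \<in> borel_measurable M"
        by (rule measurable_F_M[OF energy_measurable])
      show "0 \<le> energy_cand (2 * \<gamma>) k i \<omega>" for i \<omega> by (rule energy_cand_nonneg[OF g0])
      show "energy (2 * \<gamma>) (Suc k) \<omega> = energy_cand (2 * \<gamma>) k (idx k \<omega>) \<omega>"
        if "\<omega> \<in> space M" for \<omega>
        by (rule energy_Suc[OF that])
    qed
  qed
qed

text \<open>With the canonical choice of the new element, the three-point inequality of the resolvent
  bounds its distance to the element \<open>astar i\<close> at the solution; adding the squares of these
  distances to the Lyapunov function gives a potential that decreases for every stepsize.\<close>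

lemma AE_converges_of_canonical:
  assumes canonical: "\<And>k \<omega>. \<omega> \<in> space M \<Longrightarrow>
    a (Suc k) (idx k \<omega>) \<omega> = (1 / \<gamma>) *\<^sub>R (x k \<omega> - x (Suc k) \<omega>) + h k \<omega>"
  shows "AE \<omega> in M. (\<lambda>k. x k \<omega>) \<longlonglongrightarrow> xstar \<and> (\<forall>i \<in> {1..n}. (\<lambda>k. w k i \<omega>) \<longlonglongrightarrow> xstar)"
proof -
  \<comment> \<open>These elements are fixed once for all iterations and outcomes, because the
    potential compares successive stored elements with them.\<close>
  obtain astar where star: "\<forall>i \<in> {1..n}. astar i \<in> A i xstar" and "avg n astar = 0"
    using solution unfolding avg_op_def mem_Collect_eq by metis
  then have sum0: "(\<Sum>i = 1..n. astar i) = 0"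
    using n_pos by (simp add: avg_def)
  have mem: "\<And>i. i \<in> {1..n} \<Longrightarrow> astar i \<in> A i xstar" using star by blast
  define s where "s = \<gamma> * \<mu>"
  have s: "s > 0" using gamma_mu_pos by (simp add: s_def)
  \<comment> \<open>The canonical element that is stored if \<open>i\<close> is drawn.\<close>
  define u where "u k i \<omega> = (1 / \<gamma>) *\<^sub>R (x k \<omega> - cand k i \<omega>) + (a k i \<omega> - abar k \<omega>)" for k i \<omega>
  define S where "S b = (\<Sum>j = 1..n. (norm (b j - astar j))\<^sup>2)" for b
  \<comment> \<open>The extra weight \<open>s\<close> on the distance of \<open>x\<close> raises the
    total weight of a new point to \<open>1 + 2 * s\<close>, the factor in the three-point
    inequality.\<close>
  define U where "U k \<omega> = energy \<gamma> k \<omega> + s * (norm (x k \<omega> - xstar))\<^sup>2 + \<gamma>\<^sup>2 * S (\<lambda>j. a k j \<omega>)"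
    for k \<omega>
  define G where "G k i \<omega> = energy_cand \<gamma> k i \<omega> + s * (norm (cand k i \<omega> - xstar))\<^sup>2
      + \<gamma>\<^sup>2 * S ((\<lambda>j. a k j \<omega>)(i := u k i \<omega>))" for k i \<omega>
  have u_meas: "u k i \<in> borel_measurable (F k)" if "i \<in> {1..n}" for k i
    unfolding u_def using that
    by (intro borel_measurable_add borel_measurable_scaleR borel_measurable_diff
        borel_measurable_const x_measurable cand_measurable a_adapted abar_measurable)
  have U_meas: "U k \<in> borel_measurable (F k)" for k
    unfolding U_def S_def
    by (intro borel_measurable_add borel_measurable_times borel_measurable_norm_diff_sq
        borel_measurable_const borel_measurable_sum x_measurable a_adapted energy_measurable)
  have G_meas: "G k i \<in> borel_measurable (F k)" if i: "i \<in> {1..n}" for k i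
  proof -
    have "(\<lambda>\<omega>. ((\<lambda>j. a k j \<omega>)(i := u k i \<omega>)) j) \<in> borel_measurable (F k)" if "j \<in> {1..n}" for j
      using u_meas[OF i] a_adapted[OF that] by (cases "j = i") auto
    then show ?thesis
      unfolding G_def S_def
      by (intro borel_measurable_add borel_measurable_times borel_measurable_norm_diff_sq
          borel_measurable_const borel_measurable_sum cand_measurable[OF i]
          energy_cand_measurable[OF i])
  qed
  have U_nonneg: "0 \<le> U k \<omega>" and G_nonneg: "0 \<le> G k i \<omega>" for k i \<omega>
    using s stepsize_pos
    by (auto simp: U_def G_def S_def energy_nonneg energy_cand_nonneg sum_nonneg intro!: add_nonneg_nonneg)
  have U_Suc: "U (Suc k) \<omega> = G k (idx k \<omega>) \<omega>" if \<omega>: "\<omega> \<in> space M" for k \<omega>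
  proof -
    have "a (Suc k) j \<omega> = ((\<lambda>j. a k j \<omega>)(idx k \<omega> := u k (idx k \<omega>) \<omega>)) j" if "j \<in> {1..n}" for j
      using a_keep[OF \<omega> that, of k] canonical[OF \<omega>, of k]
      by (auto simp: u_def x_Suc[OF \<omega>] h_step[OF \<omega>])
    then show ?thesis
      unfolding U_def G_def S_def energy_Suc[OF \<omega>] x_Suc[OF \<omega>] by simp
  qed
  \<comment> \<open>In one step the weight of \<open>D\<close> drops in the mean from
    \<open>1 + s\<close> to 1 and that of \<open>W\<close> from \<open>s\<close> to
    \<open>s * (1 - 1 / n)\<close>, while that of \<open>T\<close> stays the same. The minimum is a
    common factor for both gains.\<close>
  have mean: "(1 / n) * (\<Sum>i = 1..n. G k i \<omega>) + min s (1 / n) * energy \<gamma> k \<omega> \<le> U k \<omega>"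
    if \<omega>: "\<omega> \<in> space M" for k \<omega>
  proof -
    define D W d where "D = (norm (x k \<omega> - xstar))\<^sup>2"
      and "W = (\<Sum>i = 1..n. (norm (w k i \<omega> - xstar))\<^sup>2)"
      and "d = (\<Sum>i = 1..n. (norm (cand k i \<omega> - xstar))\<^sup>2)"
    define r where "r = (\<Sum>i = 1..n. (norm (u k i \<omega> - astar i))\<^sup>2)"
    define T where "T = S (\<lambda>j. a k j \<omega>)"
    have nonneg: "0 \<le> D" "0 \<le> W" by (auto simp: D_def W_def sum_nonneg)
    \<comment> \<open>This identifies the residual of the three-point inequality.\<close>
    have scale_u: "x k \<omega> + \<gamma> *\<^sub>R (a k i \<omega> - abar k \<omega>) - \<gamma> *\<^sub>R astar i - cand k i \<omega>
        = \<gamma> *\<^sub>R (u k i \<omega> - astar i)" for i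
      using stepsize_pos by (simp add: u_def algebra_simps)
    have "(1 + 2 * s) * (norm (cand k i \<omega> - xstar))\<^sup>2 + \<gamma>\<^sup>2 * (norm (u k i \<omega> - astar i))\<^sup>2
        \<le> (norm (x k \<omega> + \<gamma> *\<^sub>R (a k i \<omega> - abar k \<omega>) - \<gamma> *\<^sub>R astar i - xstar))\<^sup>2"
      if i: "i \<in> {1..n}" for i
      using resolvent_or_three_point[OF strong[OF i] stepsize_pos mem[OF i],
          of "x k \<omega> + \<gamma> *\<^sub>R (a k i \<omega> - abar k \<omega>)"]
      unfolding cand_def[symmetric] scale_u by (simp add: s_def power_mult_distrib)
    then have "(\<Sum>i = 1..n. (1 + 2 * s) * (norm (cand k i \<omega> - xstar))\<^sup>2
          + \<gamma>\<^sup>2 * (norm (u k i \<omega> - astar i))\<^sup>2)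
        \<le> (\<Sum>i = 1..n. (norm (x k \<omega> + \<gamma> *\<^sub>R (a k i \<omega> - abar k \<omega>) - \<gamma> *\<^sub>R astar i - xstar))\<^sup>2)"
      by (rule sum_mono)
    also have "\<dots> = n * D + \<gamma>\<^sup>2 * (\<Sum>i = 1..n. (norm (a k i \<omega> - abar k \<omega> - astar i))\<^sup>2)"
      unfolding D_def by (rule sum_norm_prox_argument[OF \<omega> sum0])
    also have "\<dots> \<le> n * D + \<gamma>\<^sup>2 * T"
      unfolding T_def S_def abar_eq_avg[OF \<omega>]
      by (intro add_left_mono mult_left_mono sum_norm_diff_avg_centered_le n_pos sum0) simp
    finally have three: "(1 + 2 * s) * d + \<gamma>\<^sup>2 * r \<le> n * D + \<gamma>\<^sup>2 * T"
      by (simp add: d_def r_def sum.distrib sum_distrib_left)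
    have S_upd: "(\<Sum>i = 1..n. S ((\<lambda>j. a k j \<omega>)(i := u k i \<omega>))) = (real n - 1) * T + r"
      unfolding S_def T_def r_def
      using sum_fun_upd_diagonal[of "{1..n}" "\<lambda>j y. (norm (y - astar j))\<^sup>2"
          "\<lambda>j. a k j \<omega>" "\<lambda>i. u k i \<omega>"] by simp
    have "(\<Sum>i = 1..n. G k i \<omega>) = (1 + 2 * s) * d + \<gamma>\<^sup>2 * r + s * (real n - 1) * W
        + \<gamma>\<^sup>2 * (real n - 1) * T"
      unfolding G_def sum.distrib sum_distrib_left[symmetric] sum_energy_cand S_upd
      by (simp add: s_def d_def W_def algebra_simps)
    \<comment> \<open>The term \<open>\<gamma>\<^sup>2 * T\<close> from the three-point bound
      restores the one copy of \<open>T\<close> lost by the replacement.\<close>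
    also have "\<dots> \<le> n * (D + \<gamma>\<^sup>2 * T) + s * (real n - 1) * W"
      using three by (simp add: algebra_simps)
    finally have "(1 / n) * (\<Sum>i = 1..n. G k i \<omega>) \<le> (1 / n) * (n * (D + \<gamma>\<^sup>2 * T) + s * (real n - 1) * W)"
      by (intro mult_left_mono) auto
    also have "\<dots> = D + \<gamma>\<^sup>2 * T + s * W - 1 / n * (s * W)"
      using n_pos by (simp add: field_simps)
    finally have le: "(1 / n) * (\<Sum>i = 1..n. G k i \<omega>) \<le> D + \<gamma>\<^sup>2 * T + s * W - 1 / n * (s * W)" .
    have E: "energy \<gamma> k \<omega> = D + s * W"
      by (simp add: energy_def lyapunov_def D_def W_def s_def)
    have "min s (1 / n) * D + min s (1 / n) * (s * W) \<le> s * D + 1 / n * (s * W)"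
      using nonneg s by (intro add_mono mult_right_mono) auto
    with le show ?thesis
      unfolding U_def E D_def[symmetric] T_def[symmetric] distrib_left by linarith
  qed
  have \<epsilon>: "0 < min s (1 / n)" using s n_pos by simp
  show ?thesis
  proof (rule AE_converges_of_descent[OF measurable_F_M[OF U_meas] U_nonneg _ \<epsilon>])
    fix k
    show "(\<integral>\<^sup>+\<omega>. ennreal (U (Suc k) \<omega>) \<partial>M) + (\<integral>\<^sup>+\<omega>. ennreal (min s (1 / n) * energy \<gamma> k \<omega>) \<partial>M)
        \<le> (\<integral>\<^sup>+\<omega>. ennreal (U k \<omega>) \<partial>M)"
    proof (rule nn_integral_uniform_index_descent[OF n_pos G_meas[of _ k] G_nonneg U_Suc mean])
      show "(\<lambda>\<omega>. min s (1 / n) * energy \<gamma> k \<omega>) \<in> borel_measurable M"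
        by (intro borel_measurable_times borel_measurable_const measurable_F_M[OF energy_measurable])
      show "0 \<le> min s (1 / n) * energy \<gamma> k \<omega>" for \<omega>
        using \<epsilon> stepsize_pos by (intro mult_nonneg_nonneg energy_nonneg) auto
      show "U k \<in> borel_measurable M" by (rule measurable_F_M[OF U_meas])
    qed
  next
    fix \<omega> assume "\<omega> \<in> space M"
    then show "U 0 \<omega> = lyapunov n \<gamma> \<mu> xstar x0 w0 + s * (norm (x0 - xstar))\<^sup>2 + \<gamma>\<^sup>2 * S a0"
      by (simp add: U_def S_def energy_init x_init a_init)
  qed
qed

end

text \<open>The alternatives for almost sure convergence match two potentials. With rate at most 1
  doubling the weight of the \<open>w\<close> part suffices; with the canonical element the
  three-point inequality controls the stored elements for every stepsize. A rate above 1 by itself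
  gives no decay of the expectation.\<close>

theorem theorem4:
  fixes M :: "'w measure" and F :: "nat \<Rightarrow> 'w measure"
    and n :: nat and idx :: "nat \<Rightarrow> 'w \<Rightarrow> nat"
    and A :: "nat \<Rightarrow> 'a \<Rightarrow> 'a::euclidean_space set"
    and \<mu> \<delta> \<gamma> :: real and xstar :: 'a
    and x0 :: 'a and w0 a0 :: "nat \<Rightarrow> 'a"
    and x :: "nat \<Rightarrow> 'w \<Rightarrow> 'a" and w a :: "nat \<Rightarrow> nat \<Rightarrow> 'w \<Rightarrow> 'a"
    and abar h :: "nat \<Rightarrow> 'w \<Rightarrow> 'a"
  assumes "n \<ge> 2" and "\<mu> > 0" and "\<delta> > 0"
    and "\<And>i. i \<in> {1..n} \<Longrightarrow> strongly_max_monotone_op \<mu> (A i)"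
    and "strongly_max_monotone_op \<mu> (avg_op n A)"
    and "0 \<in> avg_op n A xstar"
    and "\<And>y. 0 \<in> avg_op n A y \<Longrightarrow> y = xstar"
    and "average_similarity n A xstar \<delta>"
    and "point_saga M F n idx A \<gamma> x0 w0 a0 x w a abar h"
  shows "(\<forall>k. integrable M (\<lambda>\<omega>. lyapunov n \<gamma> \<mu> xstar (x k \<omega>) (\<lambda>i. w k i \<omega>)) \<and>
              (\<integral>\<omega>. lyapunov n \<gamma> \<mu> xstar (x k \<omega>) (\<lambda>i. w k i \<omega>) \<partial>M)
                \<le> rate n \<gamma> \<mu> \<delta> ^ k * lyapunov n \<gamma> \<mu> xstar x0 w0) \<and>
         (rate n \<gamma> \<mu> \<delta> \<le> 1 \<or>
          (\<forall>k. \<forall>\<omega> \<in> space M. a (Suc k) (idx k \<omega>) \<omega>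
                 = (1 / \<gamma>) *\<^sub>R (x k \<omega> - x (Suc k) \<omega>) + h k \<omega>)
          \<longrightarrow> (AE \<omega> in M. (\<lambda>k. x k \<omega>) \<longlonglongrightarrow> xstar \<and>
                 (\<forall>i \<in> {1..n}. (\<lambda>k. w k i \<omega>) \<longlonglongrightarrow> xstar)))"
proof -
  interpret point_saga_solution M F n idx A \<gamma> x0 w0 a0 x w a abar h \<mu> xstar
  proof (rule point_saga_solution.intro[OF assms(9)], rule point_saga_solution_axioms.intro)
    show "0 < n" using assms(1) by simp
  qed (fact assms)+
  have energy: "energy \<gamma> k = (\<lambda>\<omega>. lyapunov n \<gamma> \<mu> xstar (x k \<omega>) (\<lambda>i. w k i \<omega>))" for k
    by (rule ext) (rule energy_def)
  show ?thesis
  proof (intro conjI allI impI)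
    fix k
    show "integrable M (\<lambda>\<omega>. lyapunov n \<gamma> \<mu> xstar (x k \<omega>) (\<lambda>i. w k i \<omega>))"
      using integrable_energy[OF assms(8), of k] unfolding energy .
    show "(\<integral>\<omega>. lyapunov n \<gamma> \<mu> xstar (x k \<omega>) (\<lambda>i. w k i \<omega>) \<partial>M)
        \<le> rate n \<gamma> \<mu> \<delta> ^ k * lyapunov n \<gamma> \<mu> xstar x0 w0"
      using integral_energy_le[OF assms(8), of k] unfolding energy .
  next
    assume "rate n \<gamma> \<mu> \<delta> \<le> 1 \<or>
      (\<forall>k. \<forall>\<omega> \<in> space M. a (Suc k) (idx k \<omega>) \<omega>
         = (1 / \<gamma>) *\<^sub>R (x k \<omega> - x (Suc k) \<omega>) + h k \<omega>)"
    then show "AE \<omega> in M. (\<lambda>k. x k \<omega>) \<longlonglongrightarrow> xstar \<and> (\<forall>i \<in> {1..n}. (\<lambda>k. w k i \<omega>) \<longlonglongrightarrow> xstar)"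
    proof
      assume "rate n \<gamma> \<mu> \<delta> \<le> 1"
      then show ?thesis by (rule AE_converges_of_rate_le_1[OF assms(8)])
    next
      assume "\<forall>k. \<forall>\<omega> \<in> space M. a (Suc k) (idx k \<omega>) \<omega>
         = (1 / \<gamma>) *\<^sub>R (x k \<omega> - x (Suc k) \<omega>) + h k \<omega>"
      then show ?thesis by (intro AE_converges_of_canonical) blast
    qed
  qed
qed

end
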